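(* Let $\Delta_{333}$ be the hyperdeterminant of $3\times 3\times 3$ arrays over $\mathbb{C}$ (determined up to a nonzero scalar multiple), and let $I_6, I_9, I_{12}$ be the fundamental invariants of degrees $6, 9, 12$ for $SL_3(\mathbb{C})\times SL_3(\mathbb{C})\times SL_3(\mathbb{C})$ acting on $\mathbb{C}^3\otimes\mathbb{C}^3\otimes\mathbb{C}^3$, normalized as specified in the context. Then, up to a nonzero scalar multiple, \[ \Delta_{333} = I_6^3 I_9^2 - I_6^2 I_{12}^2 + 36\, I_6 I_9^2 I_{12} + 108\, I_9^4 - 32\, I_{12}^3 . \]
   Context: Arrays. A $3\times3\times3$ array $M=(x_{ijk})_{1\le i,j,k\le 3}$ with complex entries is identified with the element $\sum_{i,j,k} x_{ijk}\, e_i\otimes e_j\otimes e_k$ of $\mathbb{C}^3\otimes\mathbb{C}^3\otimes\mathbb{C}^3$, where $e_1,e_2,e_3$ is the standard basis. The group $G=SL_3(\mathbb{C})\times SL_3(\mathbb{C})\times SL_3(\mathbb{C})$ acts by $(g_1,g_2,g_3)\cdot(a\otimes b\otimes c)=g_1a\otimes g_2b\otimes g_3c$. An invariant is a polynomial in the 27 variables $x_{ijk}$ that is constant on $G$-orbits. The algebra of invariants is a polynomial algebra freely generated by homogeneous invariants of degrees 6, 9 and 12 (Vinberg). Hyperdeterminant. Let $X\subset\mathbb{P}(\mathbb{C}^3\otimes\mathbb{C}^3\otimes\mathbb{C}^3)$ be the image of the Segre embedding $([a],[b],[c])\mapsto[a\otimes b\otimes c]$, i.e. the variety of arrays of rank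 1. A nonzero array $(x_{ijk})$ also defines the hyperplane $\{[y] : \sum_{i,j,k} x_{ijk}y_{ijk}=0\}$ in $\mathbb{P}(\mathbb{C}^3\otimes\mathbb{C}^3\otimes\mathbb{C}^3)$. The projective dual variety $X^\vee$ is the Zariski closure of the set of all $[(x_{ijk})]$ whose corresponding hyperplane contains the (embedded projective) tangent space to $X$ at some point of $X$; the cone over the tangent space at $[a\otimes b\otimes c]$ is $\mathbb{C}^3\otimes b\otimes c+a\otimes\mathbb{C}^3\otimes c+a\otimes b\otimes\mathbb{C}^3$. The variety $X^\vee$ is an irreducible hypersurface, and $\Delta_{333}$ is the nonzero homogeneous polynomial of minimal degree in the $x_{ijk}$ vanishing on $X^\vee$ (equivalently, the irreducible defining polynomial of $X^\vee$), which is unique up to a nonzero scalar. It has degree 36. Normalization of the fundamental invariants. Let $E_{ijk}$ be the array with entry 1 in position $(i,j,k)$ and 0 elsewhere, and put $X_1=E_{111}+E_{222}+E_{333}$, $X_2=E_{123}+E_{231}+E_{312}$, $X_3=E_{132}+E_{213}+E_{321}$. A $G$-invariant polynomial is uniquely determined by its restriction to the space of arrays $u=a_1X_1+a_2X_2+a_3X_3$, $a_1,a_2,a_3\in\mathbb{C}$. The invariants $I_6,I_9,I_{12}$ are the homogeneous $G$-invariant polynomials of degrees $6,9,12$ whose values on $u$ are \[ I_6(u)=a_1^6+a_2^6+a_3^6-10a_1^3a_2^3-10a_1^3a_3^3-10a_2^3a_3^3, \] \[ I_9(u)=-(a_1-a_2)(a_1-a_3)(a_2-a_3)(a_1^2+a_1a_2+a_2^2)(a_1^2+a_1a_3+a_3^2)(a_2^2+a_2a_3+a_3^2),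 \] \[ I_{12}(u)=a_1^3a_2^9+a_1^9a_2^3+a_1^9a_3^3+a_1^3a_3^9+a_2^3a_3^9+a_2^9a_3^3-4a_1^6a_2^6-4a_1^6a_3^6-4a_2^6a_3^6+2a_1^3a_2^3a_3^6+2a_1^3a_2^6a_3^3+2a_1^6a_2^3a_3^3 . \] *)

theory Defs
  imports "HOL-Analysis.Analysis" "HOL-Library.Poly_Mapping"
begin

section \<open>Arrays and the group action\<close>

text \<open>The index type \<open>3\<close> has the elements \<open>1\<close>, \<open>2\<close>, \<open>3\<close> (with \<open>3 = 0\<close>), so the entry
  $x_{ijk}$ of an array is \<open>x $ i $ j $ k\<close>.\<close>

type_synonym array = "complex ^ 3 ^ 3 ^ 3"

definition tensor :: "complex ^ 3 \<Rightarrow> complex ^ 3 \<Rightarrow> complex ^ 3 \<Rightarrow> array"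
  where "tensor a b c = (\<chi> i j k. a $ i * b $ j * c $ k)"

definition SL3 :: "(complex ^ 3 ^ 3) set"
  where "SL3 = {A. det A = 1}"

text \<open>The linear extension of $a \otimes b \otimes c \mapsto g_1 a \otimes g_2 b \otimes g_3 c$;
  see lemma \<open>act_tensor\<close>.\<close>

definition act ::
  "complex ^ 3 ^ 3 \<Rightarrow> complex ^ 3 ^ 3 \<Rightarrow> complex ^ 3 ^ 3 \<Rightarrow> array \<Rightarrow> array"
  where "act g1 g2 g3 x =
    (\<chi> p q r. \<Sum>i\<in>UNIV. \<Sum>j\<in>UNIV. \<Sum>k\<in>UNIV. g1 $ p $ i * g2 $ q $ j * g3 $ r $ k * x $ i $ j $ k)"

lemma act_tensor: "act g1 g2 g3 (tensor a b c) = tensor (g1 *v a) (g2 *v b) (g3 *v c)"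
  by (simp add: act_def tensor_def matrix_vector_mult_def vec_eq_iff sum_3 algebra_simps)


section \<open>Polynomials in the 27 entries\<close>

text \<open>A monomial maps the index $(i,j,k)$ of a variable $x_{ijk}$ to its exponent; a polynomial
  maps monomials to coefficients. The ring operations are those of \<open>Poly_Mapping\<close>.\<close>

type_synonym array_poly = "((3 \<times> 3 \<times> 3) \<Rightarrow>\<^sub>0 nat) \<Rightarrow>\<^sub>0 complex"

definition eval_poly :: "array_poly \<Rightarrow> array \<Rightarrow> complex"
  where "eval_poly p x = (\<Sum>m\<in>Poly_Mapping.keys p. Poly_Mapping.lookup p m *
    (\<Prod>(i, j, k)\<in>UNIV. (x $ i $ j $ k) ^ Poly_Mapping.lookup m (i, j, k)))"

definition const_poly :: "complex \<Rightarrow> array_poly"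
  where "const_poly c = Poly_Mapping.single 0 c"

definition monom_degree :: "((3 \<times> 3 \<times> 3) \<Rightarrow>\<^sub>0 nat) \<Rightarrow> nat"
  where "monom_degree m = (\<Sum>v\<in>UNIV. Poly_Mapping.lookup m v)"

text \<open>The zero polynomial is homogeneous of every degree.\<close>

definition homogeneous_poly :: "nat \<Rightarrow> array_poly \<Rightarrow> bool"
  where "homogeneous_poly d p \<longleftrightarrow> (\<forall>m\<in>Poly_Mapping.keys p. monom_degree m = d)"

definition invariant_poly :: "array_poly \<Rightarrow> bool"
  where "invariant_poly p \<longleftrightarrow>
    (\<forall>g1\<in>SL3. \<forall>g2\<in>SL3. \<forall>g3\<in>SL3. \<forall>x. eval_poly p (act g1 g2 g3 x) = eval_poly p x)"


section \<open>The hyperdeterminant\<close>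

text \<open>A point $[x]$ of the projective space of arrays is represented by any nonzero \<open>x\<close> in its
  class, a subset of the projective space by the set of all representatives of its points, and a
  projective linear subspace by the linear subspace that is its affine cone.\<close>

definition hyperplane :: "array \<Rightarrow> array set"
  where "hyperplane x =
    {y. (\<Sum>i\<in>UNIV. \<Sum>j\<in>UNIV. \<Sum>k\<in>UNIV. x $ i $ j $ k * y $ i $ j $ k) = 0}"

text \<open>The cone over the embedded tangent space of the Segre variety at
  $[a \otimes b \otimes c]$, where \<open>a\<close>, \<open>b\<close>, \<open>c\<close> are nonzero.\<close>

definition segre_tangent :: "complex ^ 3 \<Rightarrow> complex ^ 3 \<Rightarrow> complex ^ 3 \<Rightarrow> array set"
  where "segre_tangent a b c = {tensor u b c + tensor a v c + tensor a b w | u v w. True}"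

definition tangent_hyperplanes :: "array set"
  where "tangent_hyperplanes =
    {x. x \<noteq> 0 \<and> (\<exists>a b c. a \<noteq> 0 \<and> b \<noteq> 0 \<and> c \<noteq> 0 \<and> segre_tangent a b c \<subseteq> hyperplane x)}"

definition projective_zariski_closure :: "array set \<Rightarrow> array set"
  where "projective_zariski_closure S =
    {x. x \<noteq> 0 \<and>
      (\<forall>d p. homogeneous_poly d p \<and> (\<forall>y\<in>S. eval_poly p y = 0) \<longrightarrow> eval_poly p x = 0)}"

definition segre_dual :: "array set"
  where "segre_dual = projective_zariski_closure tangent_hyperplanes"

definition form_vanishing_on_dual :: "nat \<Rightarrow> array_poly \<Rightarrow> bool"
  where "form_vanishing_on_dual d p \<longleftrightarrow>
    p \<noteq> 0 \<and> homogeneous_poly d p \<and> (\<forall>x\<in>segre_dual. eval_poly p x = 0)"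

text \<open>Since the hyperdeterminant is determined only up to a nonzero scalar, it is a predicate.\<close>

definition is_hyperdeterminant :: "array_poly \<Rightarrow> bool"
  where "is_hyperdeterminant D \<longleftrightarrow>
    (\<exists>d. form_vanishing_on_dual d D \<and> (\<forall>e p. form_vanishing_on_dual e p \<longrightarrow> d \<le> e))"


section \<open>The fundamental invariants\<close>

definition unit_array :: "3 \<Rightarrow> 3 \<Rightarrow> 3 \<Rightarrow> array"
  where "unit_array i j k = (\<chi> p q r. if p = i \<and> q = j \<and> r = k then 1 else 0)"

definition X1 :: array
  where "X1 = unit_array 1 1 1 + unit_array 2 2 2 + unit_array 3 3 3"

definition X2 :: array
  where "X2 = unit_array 1 2 3 + unit_array 2 3 1 + unit_array 3 1 2"

definition X3 :: array
  where "X3 = unit_array 1 3 2 + unit_array 2 1 3 + unit_array 3 2 1"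

definition scale_array :: "complex \<Rightarrow> array \<Rightarrow> array"
  where "scale_array c x = (\<chi> i j k. c * x $ i $ j $ k)"

definition normal_array :: "complex \<Rightarrow> complex \<Rightarrow> complex \<Rightarrow> array"
  where "normal_array a1 a2 a3 = scale_array a1 X1 + scale_array a2 X2 + scale_array a3 X3"

definition is_I6 :: "array_poly \<Rightarrow> bool"
  where "is_I6 p \<longleftrightarrow> homogeneous_poly 6 p \<and> invariant_poly p \<and>
    (\<forall>a1 a2 a3. eval_poly p (normal_array a1 a2 a3) =
      a1^6 + a2^6 + a3^6 - 10 * a1^3 * a2^3 - 10 * a1^3 * a3^3 - 10 * a2^3 * a3^3)"

definition is_I9 :: "array_poly \<Rightarrow> bool"
  where "is_I9 p \<longleftrightarrow> homogeneous_poly 9 p \<and> invariant_poly p \<and>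
    (\<forall>a1 a2 a3. eval_poly p (normal_array a1 a2 a3) =
      - ((a1 - a2) * (a1 - a3) * (a2 - a3) * (a1^2 + a1 * a2 + a2^2) *
         (a1^2 + a1 * a3 + a3^2) * (a2^2 + a2 * a3 + a3^2)))"

definition is_I12 :: "array_poly \<Rightarrow> bool"
  where "is_I12 p \<longleftrightarrow> homogeneous_poly 12 p \<and> invariant_poly p \<and>
    (\<forall>a1 a2 a3. eval_poly p (normal_array a1 a2 a3) =
      a1^3 * a2^9 + a1^9 * a2^3 + a1^9 * a3^3 + a1^3 * a3^9 + a2^3 * a3^9 + a2^9 * a3^3
      - 4 * a1^6 * a2^6 - 4 * a1^6 * a3^6 - 4 * a2^6 * a3^6
      + 2 * a1^3 * a2^3 * a3^6 + 2 * a1^3 * a2^6 * a3^3 + 2 * a1^6 * a2^3 * a3^3)"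

end

theory Submission
  imports Defs "HOL-Computational_Algebra.Polynomial_Factorial" "HOL-Computational_Algebra.Field_as_Ring"
begin

text \<open>
  Let \<open>F\<close> be the combination of the three invariants in the theorem, a form of degree \<open>36\<close>. On the
  normal arrays \<open>a X1 + b X2 + c X3\<close> it equals, up to the factor \<open>-4\<close>, the cube of the product of
  twelve linear forms, namely \<open>a\<close>, \<open>b\<close>, \<open>c\<close> and \<open>a + x b + y c\<close> with cube roots of unity \<open>x\<close>, \<open>y\<close>.
  Their zero sets, the mirrors, are permuted transitively by the triples of matrices that preserve
  the normal arrays. The theorem results from two facts about degenerate arrays, those whose hyperplane is tangent
  to the Segre variety:

  \<^item> \<open>F\<close> vanishes on them (\<open>F_degenerate\<close>), so that a hyperdeterminant has degree at most \<open>36\<close>;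
  \<^item> every form \<open>p\<close> of degree at most \<open>36\<close> that vanishes on them is a multiple of \<open>F\<close>
    (\<open>tangent_form_proportional\<close>).

  For the first fact, move the point of tangency to \<open>e\<^sub>1 \<otimes> e\<^sub>1 \<otimes> e\<^sub>1\<close> and degenerate by a
  one-parameter subgroup, which does not change \<open>F\<close>, until only the twelve entries with exactly one
  index \<open>1\<close> remain. In this twelve-dimensional space the orbits of the normal arrays with \<open>a = 0\<close>, where
  \<open>F\<close> is zero, have tangent vectors in all directions.

  For the second fact, replace the coefficient of \<open>X1\<close> by three independent diagonal entries. The
  array is degenerate if one of them is zero, so \<open>p\<close> is divisible by their product, and on normal arrays
  by \<open>a\<^sup>3\<close>. This applies to every translate \<open>p \<circ> g\<close> and, by symmetry, to all twelve mirrors. The twelve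
  cubes have total degree \<open>36\<close>, so \<open>p (g u) = r(g) F (g u)\<close> for normal arrays \<open>u\<close>, with a factor \<open>r(g)\<close>
  that may still depend on \<open>g\<close>. Comparing the leading coefficients of both sides at \<open>a = 0\<close> shows that
  \<open>r\<close> does not change when \<open>g\<close> is multiplied by a torus element (\<open>ratio_torus_limit\<close>). The tangent
  vectors of the torus orbits, for the tori belonging to the twelve mirrors, span together with the
  normal arrays the space of all arrays (\<open>frames_span\<close>).

  Both arguments end in the same way. A relation along orbits passes to the derivatives in all
  directions tangent to the family, hence to all higher derivatives, and then Taylor's formula extends it
  to the whole space (\<open>proportional_spread\<close>).
\<close>

section \<open>Polynomial functions\<close>

text \<open>The domain is left arbitrary, so that restricting a polynomial function to a line, to a slice or
  along an orbit is composition with a map whose coordinates are again polynomial functions.\<close>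

inductive_set polyfuns :: "('a \<Rightarrow> complex) set \<Rightarrow> ('a \<Rightarrow> complex) set"
  for C :: "('a \<Rightarrow> complex) set" where
  const: "(\<lambda>_. k) \<in> polyfuns C"
| coord: "c \<in> C \<Longrightarrow> c \<in> polyfuns C"
| add: "f \<in> polyfuns C \<Longrightarrow> g \<in> polyfuns C \<Longrightarrow> (\<lambda>x. f x + g x) \<in> polyfuns C"
| mult: "f \<in> polyfuns C \<Longrightarrow> g \<in> polyfuns C \<Longrightarrow> (\<lambda>x. f x * g x) \<in> polyfuns C"

lemmas polyfuns_intros = polyfuns.const polyfuns.add polyfuns.mult

lemma polyfuns_diff:
  assumes "f \<in> polyfuns C" "g \<in> polyfuns C"
  shows "(\<lambda>x. f x - g x) \<in> polyfuns C"
proof -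
  have "(\<lambda>x. f x + (\<lambda>_. -1) x * g x) \<in> polyfuns C"
    using assms by (intro polyfuns_intros)
  then show ?thesis by simp
qed

lemma polyfuns_power: "f \<in> polyfuns C \<Longrightarrow> (\<lambda>x. f x ^ n) \<in> polyfuns C"
  by (induction n) (auto intro: polyfuns_intros)

lemma polyfuns_sum: "(\<And>i. i \<in> A \<Longrightarrow> f i \<in> polyfuns C) \<Longrightarrow> (\<lambda>x. \<Sum>i\<in>A. f i x) \<in> polyfuns C"
  by (induction A rule: infinite_finite_induct) (auto intro: polyfuns_intros)

lemma polyfuns_prod: "(\<And>i. i \<in> A \<Longrightarrow> f i \<in> polyfuns C) \<Longrightarrow> (\<lambda>x. \<Prod>i\<in>A. f i x) \<in> polyfuns C"
  by (induction A rule: infinite_finite_induct) (auto intro: polyfuns_intros)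

lemma polyfuns_compose:
  assumes "f \<in> polyfuns C" and "\<And>c. c \<in> C \<Longrightarrow> (\<lambda>x. c (\<phi> x)) \<in> polyfuns C'"
  shows "(\<lambda>x. f (\<phi> x)) \<in> polyfuns C'"
  using assms(1) by induction (auto intro: polyfuns_intros assms(2))

abbreviation univariate :: "(complex \<Rightarrow> complex) set"
  where "univariate \<equiv> polyfuns {\<lambda>s. s}"

lemma univariate_ident: "(\<lambda>s. s) \<in> univariate"
  by (rule polyfuns.coord) simp

lemma univariate_poly:
  assumes "f \<in> univariate" obtains P where "f = poly P"
proof -
  have "\<exists>P. \<forall>s. f s = poly P s"
    using assms
  proof induction
    case (const k)
    show ?case by (rule exI[of _ "[:k:]"]) simp
  next
    case (coord c)
    then show ?case by (intro exI[of _ "[:0, 1:]"]) simp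
  next
    case (add f g)
    then obtain P Q where "\<forall>s. f s = poly P s" "\<forall>s. g s = poly Q s" by blast
    then show ?case by (intro exI[of _ "P + Q"]) simp
  next
    case (mult f g)
    then obtain P Q where "\<forall>s. f s = poly P s" "\<forall>s. g s = poly Q s" by blast
    then show ?case by (intro exI[of _ "P * Q"]) simp
  qed
  then show ?thesis using that by blast
qed

lemma univariate_finite_zeros:
  assumes "f \<in> univariate" "f a \<noteq> 0"
  shows "finite {s. f s = 0}"
proof -
  obtain P where "f = poly P" using univariate_poly[OF assms(1)] .
  then show ?thesis using poly_roots_finite[of P] assms(2) by force
qed

text \<open>A complex polynomial cannot vanish at all but finitely many points. This takes the place of
  continuity whenever an identity is proved for generic parameters and used at a special one.\<close>

lemma univariate_zero:
  assumes "f \<in> univariate" "finite B" "\<And>s. s \<notin> B \<Longrightarrow> f s = 0"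
  shows "f s = 0"
proof (rule ccontr)
  assume "f s \<noteq> 0"
  then have "finite {s. f s = 0}" using assms(1) by (rule univariate_finite_zeros[rotated])
  moreover have "UNIV = B \<union> {s. f s = 0}" using assms(3) by auto
  ultimately have "finite (UNIV :: complex set)" using assms(2) by (metis finite_Un)
  then show False using infinite_UNIV_char_0 by blast
qed

lemma univariate_eventually_nonzero:
  assumes "f \<in> univariate" "f a \<noteq> 0"
  shows "eventually (\<lambda>s. f s \<noteq> 0) (nhds a)"
proof -
  obtain P where P: "f = poly P" using univariate_poly[OF assms(1)] .
  have "(f \<longlongrightarrow> f a) (at a)"
    using poly_isCont[of a P] unfolding P isCont_def .
  then have "eventually (\<lambda>s. f s \<noteq> 0) (at a)"
    using assms(2) by (rule tendsto_imp_eventually_ne)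
  then show ?thesis
    using assms(2) by (simp add: eventually_nhds_conv_at)
qed


section \<open>Division of polynomial functions by coordinates\<close>

abbreviation coords :: "((nat \<Rightarrow> complex) \<Rightarrow> complex) set"
  where "coords \<equiv> range (\<lambda>n x. x n)"

lemma coords_polyfun: "(\<lambda>x. x n) \<in> polyfuns coords"
  by (rule polyfuns.coord) simp

lemma polyfun_line_upd:
  assumes "f \<in> polyfuns coords" shows "(\<lambda>s. f (x(n := s))) \<in> univariate"
proof (rule polyfuns_compose[OF assms])
  fix c :: "(nat \<Rightarrow> complex) \<Rightarrow> complex" assume "c \<in> coords"
  then obtain m where "c = (\<lambda>x. x m)" by auto
  then show "(\<lambda>s. c (x(n := s))) \<in> univariate"
    by (cases "m = n") (auto intro: univariate_ident polyfuns.const)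
qed

lemma polyfun_upd:
  assumes "f \<in> polyfuns coords" shows "(\<lambda>x. f (x(n := 0))) \<in> polyfuns coords"
proof (rule polyfuns_compose[OF assms])
  fix c :: "(nat \<Rightarrow> complex) \<Rightarrow> complex" assume "c \<in> coords"
  then obtain m where "c = (\<lambda>x. x m)" by auto
  then show "(\<lambda>x. c (x(n := 0))) \<in> polyfuns coords"
    by (cases "m = n") (auto intro: coords_polyfun polyfuns.const)
qed

text \<open>Hadamard's lemma. In the product case the quotient comes from
  \<open>f g - f\<^sub>0 g\<^sub>0 = (f - f\<^sub>0) g + f\<^sub>0 (g - g\<^sub>0)\<close>.\<close>

lemma polyfun_split_coord:
  assumes "f \<in> polyfuns coords"
  shows "\<exists>q \<in> polyfuns coords. \<forall>x. f x - f (x(n := 0)) = x n * q x"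
  using assms
proof induction
  case (const k)
  show ?case by (rule bexI[of _ "\<lambda>_. 0"]) (auto intro: polyfuns_intros)
next
  case (coord c)
  then obtain m where m: "c = (\<lambda>x. x m)" by auto
  show ?case
  proof (cases "m = n")
    case True
    then show ?thesis unfolding m
      by (intro bexI[of _ "\<lambda>_. 1"]) (auto intro: polyfuns_intros)
  next
    case False
    then show ?thesis unfolding m
      by (intro bexI[of _ "\<lambda>_. 0"]) (auto intro: polyfuns_intros)
  qed
next
  case (add f g)
  then obtain p q where p: "p \<in> polyfuns coords" "\<forall>x. f x - f (x(n := 0)) = x n * p x"
    and q: "q \<in> polyfuns coords" "\<forall>x. g x - g (x(n := 0)) = x n * q x" by blast
  show ?case
  proof (intro bexI[of _ "\<lambda>x. p x + q x"] allI)
    fix x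
    have "f x = f (x(n := 0)) + x n * p x" "g x = g (x(n := 0)) + x n * q x"
      using p(2) q(2) by (metis add.commute diff_add_cancel)+
    then show "f x + g x - (f (x(n := 0)) + g (x(n := 0))) = x n * (p x + q x)"
      by (simp add: algebra_simps)
  qed (intro polyfuns_intros p q)
next
  case (mult f g)
  then obtain p q where p: "p \<in> polyfuns coords" "\<forall>x. f x - f (x(n := 0)) = x n * p x"
    and q: "q \<in> polyfuns coords" "\<forall>x. g x - g (x(n := 0)) = x n * q x" by blast
  show ?case
  proof (intro bexI[of _ "\<lambda>x. p x * g x + f (x(n := 0)) * q x"] allI)
    fix x
    have "f x = f (x(n := 0)) + x n * p x" "g x = g (x(n := 0)) + x n * q x"
      using p(2) q(2) by (metis add.commute diff_add_cancel)+
    then show "f x * g x - f (x(n := 0)) * g (x(n := 0)) = x n * (p x * g x + f (x(n := 0)) * q x)"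
      by (simp add: algebra_simps)
  qed (intro polyfuns_intros p q mult.hyps polyfun_upd)
qed

lemma polyfun_vanish_split:
  assumes "f \<in> polyfuns coords" "\<And>x. x n = 0 \<Longrightarrow> f x = 0"
  obtains q where "q \<in> polyfuns coords" "\<And>x. f x = x n * q x"
proof -
  obtain q where "q \<in> polyfuns coords" "\<forall>x. f x - f (x(n := 0)) = x n * q x"
    using polyfun_split_coord[OF assms(1)] by blast
  then show ?thesis using assms(2) that by auto
qed

text \<open>A coordinate is not a zero divisor for the functions on another coordinate hyperplane.\<close>

lemma polyfun_cancel_coord:
  assumes "q \<in> polyfuns coords" "m \<noteq> n" "\<And>x. x m = 0 \<Longrightarrow> x n * q x = 0" "x m = 0"
  shows "q x = 0"
proof -
  have "q (x(n := s)) = 0" for s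
  proof (rule univariate_zero[OF polyfun_line_upd[OF assms(1)], of "{0}"])
    fix s :: complex assume "s \<notin> {0}"
    then show "q (x(n := s)) = 0" using assms(3)[of "x(n := s)"] assms(2,4) by simp
  qed simp
  from this[of "x n"] show ?thesis by simp
qed

lemma polyfun_vanish_split3:
  assumes "f \<in> polyfuns coords" "\<And>x. x 0 = 0 \<or> x 1 = 0 \<or> x 2 = 0 \<Longrightarrow> f x = 0"
  obtains q where "q \<in> polyfuns coords" "\<And>x. f x = x 0 * x 1 * x 2 * q x"
proof -
  obtain q0 where q0: "q0 \<in> polyfuns coords" "\<And>x. f x = x 0 * q0 x"
    using polyfun_vanish_split[OF assms(1), of 0] assms(2) by metis
  have z0: "q0 x = 0" if "x 1 = 0 \<or> x 2 = 0" for x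
    using that polyfun_cancel_coord[OF q0(1), of 1 0 x] polyfun_cancel_coord[OF q0(1), of 2 0 x]
      assms(2) q0(2) by (metis one_neq_zero zero_neq_numeral)
  obtain q1 where q1: "q1 \<in> polyfuns coords" "\<And>x. q0 x = x 1 * q1 x"
    using polyfun_vanish_split[OF q0(1), of 1] z0 by metis
  have z1: "q1 x = 0" if "x 2 = 0" for x
    using that polyfun_cancel_coord[OF q1(1), of 2 1 x] z0 q1(2)
    by (metis numeral_eq_one_iff semiring_norm(85))
  obtain q2 where q2: "q2 \<in> polyfuns coords" "\<And>x. q1 x = x 2 * q2 x"
    using polyfun_vanish_split[OF q1(1), of 2] z1 by metis
  show ?thesis
    by (rule that[OF q2(1)]) (simp add: q0(2) q1(2) q2(2))
qed


section \<open>Directional derivatives and Taylor expansion\<close>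

definition entries :: "(array \<Rightarrow> complex) set"
  where "entries = {\<lambda>x. x $ i $ j $ k | i j k. True}"

lemma entry_polyfun: "(\<lambda>x. x $ i $ j $ k) \<in> polyfuns entries"
  by (rule polyfuns.coord) (auto simp: entries_def)

lemma scale_array_nth [simp]: "scale_array c x $ i $ j $ k = c * x $ i $ j $ k"
  by (simp add: scale_array_def)

lemma array_eqI: "(\<And>i j k. x $ i $ j $ k = y $ i $ j $ k) \<Longrightarrow> x = (y :: array)"
  by (simp add: vec_eq_iff)

lemma polyfun_line:
  assumes "f \<in> polyfuns entries" shows "(\<lambda>s. f (x + scale_array s y)) \<in> univariate"
  by (rule polyfuns_compose[OF assms])
    (auto simp: entries_def intro!: univariate_ident polyfuns_intros)

definition dirderiv :: "array \<Rightarrow> (array \<Rightarrow> complex) \<Rightarrow> array \<Rightarrow> complex"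
  where "dirderiv y f x = deriv (\<lambda>s. f (x + scale_array s y)) 0"

text \<open>The induction needs all four properties at once. They hold for the product by the Leibniz
  rule.\<close>

lemma polyfun_gradient:
  assumes "f \<in> polyfuns entries"
  shows "\<exists>D. (\<forall>y. D y \<in> polyfuns entries) \<and>
    (\<forall>x y. ((\<lambda>s. f (x + scale_array s y)) has_field_derivative D y x) (at 0)) \<and>
    (\<forall>x y z. D (y + z) x = D y x + D z x) \<and> (\<forall>x c y. D (scale_array c y) x = c * D y x)"
  using assms
proof induction
  case (const k)
  show ?case by (rule exI[of _ "\<lambda>_ _. 0"]) (auto intro: polyfuns_intros)
next
  case (coord c)
  then obtain i j k where c: "c = (\<lambda>x. x $ i $ j $ k)" by (auto simp: entries_def)
  show ?case unfolding c
    by (rule exI[of _ "\<lambda>y _. y $ i $ j $ k"])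
      (auto intro!: polyfuns_intros derivative_eq_intros)
next
  case (add f g)
  then obtain D E where D: "\<And>y. D y \<in> polyfuns entries"
      "\<And>x y. ((\<lambda>s. f (x + scale_array s y)) has_field_derivative D y x) (at 0)"
      "\<And>x y z. D (y + z) x = D y x + D z x" "\<And>x c y. D (scale_array c y) x = c * D y x"
    and E: "\<And>y. E y \<in> polyfuns entries"
      "\<And>x y. ((\<lambda>s. g (x + scale_array s y)) has_field_derivative E y x) (at 0)"
      "\<And>x y z. E (y + z) x = E y x + E z x" "\<And>x c y. E (scale_array c y) x = c * E y x"
    by auto
  show ?case
    by (rule exI[of _ "\<lambda>y x. D y x + E y x"])
      (auto intro!: polyfuns_intros D(1) E(1) DERIV_add D(2) E(2)
        simp: D(3,4) E(3,4) algebra_simps)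
next
  case (mult f g)
  then obtain D E where D: "\<And>y. D y \<in> polyfuns entries"
      "\<And>x y. ((\<lambda>s. f (x + scale_array s y)) has_field_derivative D y x) (at 0)"
      "\<And>x y z. D (y + z) x = D y x + D z x" "\<And>x c y. D (scale_array c y) x = c * D y x"
    and E: "\<And>y. E y \<in> polyfuns entries"
      "\<And>x y. ((\<lambda>s. g (x + scale_array s y)) has_field_derivative E y x) (at 0)"
      "\<And>x y z. E (y + z) x = E y x + E z x" "\<And>x c y. E (scale_array c y) x = c * E y x"
    by auto
  have 0: "x + scale_array 0 y = x" for x y
    by (rule array_eqI) simp
  have "((\<lambda>s. f (x + scale_array s y) * g (x + scale_array s y)) has_field_derivative
      D y x * g x + E y x * f x) (at 0)" for x y
    using DERIV_mult[OF D(2)[of x y] E(2)[of x y]] by (simp add: 0)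
  then show ?case
    by (intro exI[of _ "\<lambda>y x. D y x * g x + E y x * f x"])
      (auto intro!: polyfuns_intros D(1) E(1) mult.hyps simp: D(3,4) E(3,4) algebra_simps)
qed

lemma polyfun_dirderiv:
  assumes "f \<in> polyfuns entries"
  shows polyfuns_dirderiv: "dirderiv y f \<in> polyfuns entries"
    and dirderiv_works:
      "((\<lambda>s. f (x + scale_array s y)) has_field_derivative dirderiv y f x) (at 0)"
    and dirderiv_add: "dirderiv (y + z) f x = dirderiv y f x + dirderiv z f x"
    and dirderiv_scale: "dirderiv (scale_array c y) f x = c * dirderiv y f x"
proof -
  obtain D where D: "\<And>y. D y \<in> polyfuns entries"
      "\<And>x y. ((\<lambda>s. f (x + scale_array s y)) has_field_derivative D y x) (at 0)"
      "\<And>x y z. D (y + z) x = D y x + D z x" "\<And>x c y. D (scale_array c y) x = c * D y x"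
    using polyfun_gradient[OF assms] by auto
  have eq: "dirderiv y f = D y" for y
    by (rule ext) (simp add: dirderiv_def DERIV_imp_deriv[OF D(2)])
  show "dirderiv y f \<in> polyfuns entries"
    "((\<lambda>s. f (x + scale_array s y)) has_field_derivative dirderiv y f x) (at 0)"
    "dirderiv (y + z) f x = dirderiv y f x + dirderiv z f x"
    "dirderiv (scale_array c y) f x = c * dirderiv y f x"
    by (simp_all add: eq D)
qed

lemma dirderiv_eqI:
  assumes "f \<in> polyfuns entries" "h \<in> polyfuns entries"
    and "eventually (\<lambda>s. f (x + scale_array s y) = k * h (x + scale_array s y)) (nhds 0)"
  shows "dirderiv y f x = k * dirderiv y h x"
proof -
  have "((\<lambda>s. k * h (x + scale_array s y)) has_field_derivative k * dirderiv y h x) (at 0)"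
    using DERIV_cmult[OF dirderiv_works[OF assms(2)]] .
  moreover have "((\<lambda>s. k * h (x + scale_array s y)) has_field_derivative dirderiv y f x) (at 0)"
    using DERIV_cong_ev[OF refl assms(3) refl] dirderiv_works[OF assms(1)] by metis
  ultimately show ?thesis using DERIV_unique by blast
qed

lemma dirderiv_line:
  assumes "\<And>s. f (x + scale_array s y) = poly P s"
  shows "dirderiv y f (x + scale_array s y) = poly (pderiv P) s"
proof -
  have "x + scale_array s y + scale_array t y = x + scale_array (s + t) y" for t
    by (rule array_eqI) (simp add: algebra_simps)
  then have "(\<lambda>t. f (x + scale_array s y + scale_array t y)) = (\<lambda>t. poly P (s + t))"
    by (simp only: assms)
  moreover have "((\<lambda>t. poly P (s + t)) has_field_derivative poly (pderiv P) s) (at 0)"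
    using DERIV_shift[of "poly P" "poly (pderiv P) s" 0 s] poly_DERIV[of P s]
    by (simp add: add.commute)
  ultimately show ?thesis
    unfolding dirderiv_def by (simp add: DERIV_imp_deriv)
qed

text \<open>Taylor's formula on the complex line through \<open>x\<close> and \<open>x + y\<close>: the iterated derivatives at
  \<open>x\<close> are, up to factorials, the coefficients of the restriction of \<open>f\<close> to that line.\<close>

lemma polyfun_zero_by_derivatives:
  assumes "f \<in> polyfuns entries" "\<And>n. (dirderiv y ^^ n) f x = 0"
  shows "f (x + y) = 0"
proof -
  obtain P where P: "\<And>s. f (x + scale_array s y) = poly P s"
    using univariate_poly[OF polyfun_line[OF assms(1)]] by metis
  have "(dirderiv y ^^ n) f (x + scale_array s y) = poly ((pderiv ^^ n) P) s" for n s
    by (induction n arbitrary: s) (auto simp: P dirderiv_line)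
  moreover have 0: "x + scale_array 0 y = x" "x + scale_array 1 y = x + y"
    by (rule array_eqI; simp)+
  ultimately have "coeff ((pderiv ^^ n) P) 0 = 0" for n
    using assms(2) by (metis poly_0_coeff_0)
  then have "coeff P n = 0" for n
    by (simp add: coeff_higher_pderiv pochhammer_of_nat)
      (metis (no_types, lifting) mult_eq_0_iff pochhammer_fact fact_nonzero of_nat_1)
  then have "P = 0" by (simp add: poly_eqI)
  then show ?thesis using P[of 1] 0 by simp
qed

text \<open>This replaces density arguments. If every relation \<open>f = c h\<close> between polynomial functions along
  a family of points is inherited by the derivatives in the directions \<open>V\<close>, then it is inherited by
  the derivatives of all orders, and Taylor's formula carries it from a point \<open>pt i\<close> of the family to
  all of \<open>pt i + V\<close>, with the factor \<open>c i\<close> belonging to that point. Only the tangent directions of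
  the family have to be known.\<close>

lemma proportional_spread:
  fixes pt :: "'i \<Rightarrow> array" and c :: "'i \<Rightarrow> complex"
  assumes step: "\<And>f h i y. \<lbrakk>f \<in> polyfuns entries; h \<in> polyfuns entries;
      \<And>i. i \<in> I \<Longrightarrow> f (pt i) = c i * h (pt i); i \<in> I; y \<in> V\<rbrakk>
      \<Longrightarrow> dirderiv y f (pt i) = c i * dirderiv y h (pt i)"
    and f: "f \<in> polyfuns entries" and h: "h \<in> polyfuns entries"
    and fh: "\<And>i. i \<in> I \<Longrightarrow> f (pt i) = c i * h (pt i)" and i: "i \<in> I" and y: "y \<in> V"
  shows "f (pt i + y) = c i * h (pt i + y)"
proof -
  have pf: "(dirderiv y ^^ n) f \<in> polyfuns entries" "(dirderiv y ^^ n) h \<in> polyfuns entries" for n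
    by (induction n) (auto intro: f h polyfuns_dirderiv)
  have all: "\<forall>i\<in>I. (dirderiv y ^^ n) f (pt i) = c i * (dirderiv y ^^ n) h (pt i)" for n
  proof (induction n)
    case 0
    then show ?case using fh by simp
  next
    case (Suc n)
    then show ?case using step[OF pf, of n n] y by auto
  qed
  define e where "e = (\<lambda>x. f x - c i * h x)"
  have lin: "dirderiv y (\<lambda>x. a x - c i * b x) = (\<lambda>x. dirderiv y a x - c i * dirderiv y b x)"
    if "a \<in> polyfuns entries" "b \<in> polyfuns entries" for a b
  proof (rule ext)
    fix x
    show "dirderiv y (\<lambda>x. a x - c i * b x) x = dirderiv y a x - c i * dirderiv y b x"
      unfolding dirderiv_def[of y "\<lambda>x. a x - c i * b x"]
      by (intro DERIV_imp_deriv DERIV_diff DERIV_cmult dirderiv_works that)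
  qed
  have "(dirderiv y ^^ n) e = (\<lambda>x. (dirderiv y ^^ n) f x - c i * (dirderiv y ^^ n) h x)" for n
    by (induction n) (auto simp: e_def lin pf)
  then have "(dirderiv y ^^ n) e (pt i) = 0" for n
    using all i by simp
  moreover have "e \<in> polyfuns entries"
    unfolding e_def by (intro polyfuns_diff polyfuns_intros f h)
  ultimately have "e (pt i + y) = 0" by (rule polyfun_zero_by_derivatives[rotated])
  then show ?thesis by (simp add: e_def)
qed

section \<open>Evaluation of formal polynomials\<close>

definition monom_value :: "array \<Rightarrow> ((3 \<times> 3 \<times> 3) \<Rightarrow>\<^sub>0 nat) \<Rightarrow> complex"
  where "monom_value x m = (\<Prod>(i, j, k)\<in>UNIV. (x $ i $ j $ k) ^ Poly_Mapping.lookup m (i, j, k))"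

lemma monom_value_0 [simp]: "monom_value x 0 = 1"
  by (simp add: monom_value_def)

lemma monom_value_add: "monom_value x (m + n) = monom_value x m * monom_value x n"
  by (simp add: monom_value_def lookup_add power_add prod.distrib case_prod_unfold)

lemma eval_poly_superset:
  assumes "finite A" "Poly_Mapping.keys p \<subseteq> A"
  shows "eval_poly p x = (\<Sum>m\<in>A. Poly_Mapping.lookup p m * monom_value x m)"
  unfolding eval_poly_def monom_value_def
  by (rule sum.mono_neutral_left) (use assms in \<open>auto simp: in_keys_iff\<close>)

lemma eval_poly_single: "eval_poly (Poly_Mapping.single m c) x = c * monom_value x m"
  by (subst eval_poly_superset[of "{m}"]) (auto simp: lookup_single)

lemma eval_poly_add [simp]: "eval_poly (p + q) x = eval_poly p x + eval_poly q x"
proof -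
  let ?A = "Poly_Mapping.keys p \<union> Poly_Mapping.keys q"
  have "finite ?A" by simp
  then show ?thesis
    using keys_add[of p q]
    by (simp add: eval_poly_superset[of ?A] lookup_add distrib_right sum.distrib)
qed

lemma eval_poly_0 [simp]: "eval_poly 0 x = 0"
  by (simp add: eval_poly_def)

lemma eval_poly_sum [simp]: "eval_poly (\<Sum>a\<in>A. f a) x = (\<Sum>a\<in>A. eval_poly (f a) x)"
  by (induction A rule: infinite_finite_induct) auto

lemma eval_poly_uminus [simp]: "eval_poly (- p) x = - eval_poly p x"
  using eval_poly_add[of p "-p" x] by (simp add: add_eq_0_iff)

lemma eval_poly_diff [simp]: "eval_poly (p - q) x = eval_poly p x - eval_poly q x"
  using eval_poly_add[of p "-q" x] by simp

text \<open>The expansion into monomials reduces the evaluation of a product to that of single monomials.\<close>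

lemma array_poly_as_sum:
  "(p :: array_poly) = (\<Sum>m\<in>Poly_Mapping.keys p. Poly_Mapping.single m (Poly_Mapping.lookup p m))"
proof (rule poly_mapping_eqI)
  fix n
  show "Poly_Mapping.lookup p n = Poly_Mapping.lookup
      (\<Sum>m\<in>Poly_Mapping.keys p. Poly_Mapping.single m (Poly_Mapping.lookup p m)) n"
    by (simp add: lookup_sum lookup_single when_def in_keys_iff)
qed

lemma eval_poly_mult [simp]: "eval_poly (p * q) x = eval_poly p x * eval_poly q x"
proof -
  let ?l = Poly_Mapping.lookup and ?s = Poly_Mapping.single and ?k = Poly_Mapping.keys
  have "p * q = (\<Sum>m\<in>?k p. ?s m (?l p m)) * (\<Sum>n\<in>?k q. ?s n (?l q n))"
    using array_poly_as_sum[of p] array_poly_as_sum[of q] by simp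
  also have "\<dots> = (\<Sum>m\<in>?k p. \<Sum>n\<in>?k q. ?s (m + n) (?l p m * ?l q n))"
    by (simp add: sum_product mult_single)
  finally have "eval_poly (p * q) x = (\<Sum>m\<in>?k p. \<Sum>n\<in>?k q. (?l p m * ?l q n) * monom_value x (m + n))"
    by (simp add: eval_poly_single)
  also have "\<dots> = (\<Sum>m\<in>?k p. ?l p m * monom_value x m) * (\<Sum>n\<in>?k q. ?l q n * monom_value x n)"
    by (simp add: sum_product monom_value_add mult_ac)
  also have "\<dots> = eval_poly p x * eval_poly q x"
    by (simp add: eval_poly_superset[of "?k p"] eval_poly_superset[of "?k q"])
  finally show ?thesis .
qed

lemma eval_const_poly [simp]: "eval_poly (const_poly c) x = c"
  by (simp add: const_poly_def eval_poly_single)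

lemma eval_poly_1 [simp]: "eval_poly 1 x = 1"
  using eval_const_poly[of 1 x] by (simp add: const_poly_def)

lemma eval_poly_numeral [simp]: "eval_poly (numeral n) x = numeral n"
  using eval_const_poly[of "numeral n" x] by (simp add: const_poly_def)

lemma eval_poly_power [simp]: "eval_poly (p ^ n) x = eval_poly p x ^ n"
  by (induction n) auto

lemma eval_poly_polyfun: "eval_poly p \<in> polyfuns entries"
proof -
  have "(\<lambda>x. \<Sum>m\<in>Poly_Mapping.keys p. Poly_Mapping.lookup p m * monom_value x m) \<in> polyfuns entries"
    unfolding monom_value_def
    by (intro polyfuns_sum polyfuns_intros polyfuns_prod)
      (auto simp: case_prod_unfold intro!: polyfuns_power entry_polyfun)
  then show ?thesis
    by (simp add: eval_poly_superset[of "Poly_Mapping.keys p" p, symmetric])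
qed


section \<open>Homogeneous polynomials\<close>

lemma homogeneous_poly_scale:
  assumes "homogeneous_poly d p"
  shows "eval_poly p (scale_array c x) = c ^ d * eval_poly p x"
proof -
  have "monom_value (scale_array c x) m = c ^ monom_degree m * monom_value x m" for m
    by (simp add: monom_value_def monom_degree_def power_mult_distrib prod.distrib
        case_prod_unfold power_sum)
  then show ?thesis
    using assms unfolding homogeneous_poly_def
    by (simp add: eval_poly_superset[of "Poly_Mapping.keys p"] sum_distrib_left mult_ac)
qed

lemma homogeneous_poly_line:
  assumes "homogeneous_poly d p"
  obtains P where "degree P \<le> d" "\<And>s. eval_poly p (x + scale_array s y) = poly P s"
proof -
  define M where "M m = (\<Prod>v\<in>UNIV. case v of (i, j, k) \<Rightarrow>
    [:x $ i $ j $ k, y $ i $ j $ k:] ^ Poly_Mapping.lookup m (i, j, k))"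
    for m :: "(3 \<times> 3 \<times> 3) \<Rightarrow>\<^sub>0 nat"
  have "degree (M m) \<le> monom_degree m" for m
  proof -
    have "degree (M m) \<le> (\<Sum>v\<in>UNIV. degree (case v of (i, j, k) \<Rightarrow>
      [:x $ i $ j $ k, y $ i $ j $ k:] ^ Poly_Mapping.lookup m (i, j, k)))"
      unfolding M_def by (rule order.trans[OF degree_prod_sum_le]) simp_all
    also have "\<dots> \<le> (\<Sum>v\<in>UNIV. Poly_Mapping.lookup m v)"
    proof (rule sum_mono)
      fix v :: "3 \<times> 3 \<times> 3"
      obtain i j k where v: "v = (i, j, k)" by (cases v)
      have "degree ([:x $ i $ j $ k, y $ i $ j $ k:] ^ Poly_Mapping.lookup m v)
          \<le> degree [:x $ i $ j $ k, y $ i $ j $ k:] * Poly_Mapping.lookup m v"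
        by (rule degree_power_le)
      also have "\<dots> \<le> 1 * Poly_Mapping.lookup m v"
        by (intro mult_right_mono) auto
      finally show "degree (case v of (i, j, k) \<Rightarrow>
          [:x $ i $ j $ k, y $ i $ j $ k:] ^ Poly_Mapping.lookup m (i, j, k))
          \<le> Poly_Mapping.lookup m v"
        by (simp add: v)
    qed
    finally show ?thesis by (simp add: monom_degree_def)
  qed
  then have deg: "degree (M m) \<le> d" if "m \<in> Poly_Mapping.keys p" for m
    using that assms unfolding homogeneous_poly_def by metis
  have val: "poly (M m) s = monom_value (x + scale_array s y) m" for m s
    by (simp add: M_def monom_value_def poly_prod case_prod_unfold)
  show ?thesis
  proof (rule that)
    show "degree (\<Sum>m\<in>Poly_Mapping.keys p. smult (Poly_Mapping.lookup p m) (M m)) \<le> d"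
      by (rule degree_sum_le) (auto intro: order.trans[OF degree_smult_le] deg)
    show "eval_poly p (x + scale_array s y)
        = poly (\<Sum>m\<in>Poly_Mapping.keys p. smult (Poly_Mapping.lookup p m) (M m)) s" for s
      by (simp add: poly_sum val eval_poly_superset[of "Poly_Mapping.keys p"])
  qed
qed

lemma monom_degree_add: "monom_degree (m + n) = monom_degree m + monom_degree n"
  by (simp add: monom_degree_def lookup_add sum.distrib)

lemma homogeneous_poly_mult:
  "homogeneous_poly d p \<Longrightarrow> homogeneous_poly e q \<Longrightarrow> homogeneous_poly (d + e) (p * q)"
  using keys_mult[of p q] unfolding homogeneous_poly_def by (fastforce simp: monom_degree_add)

lemma homogeneous_poly_add:
  "homogeneous_poly d p \<Longrightarrow> homogeneous_poly d q \<Longrightarrow> homogeneous_poly d (p + q)"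
  using keys_add[of p q] unfolding homogeneous_poly_def by blast

lemma homogeneous_poly_diff:
  "homogeneous_poly d p \<Longrightarrow> homogeneous_poly d q \<Longrightarrow> homogeneous_poly d (p - q)"
  using homogeneous_poly_add[of d p "-q"] by (simp add: homogeneous_poly_def)

lemma homogeneous_poly_const: "homogeneous_poly 0 (const_poly c)"
  by (simp add: homogeneous_poly_def const_poly_def monom_degree_def)

lemma homogeneous_poly_numeral: "homogeneous_poly 0 (numeral n)"
  using homogeneous_poly_const[of "numeral n"] by (simp add: const_poly_def)

lemma homogeneous_poly_power: "homogeneous_poly d p \<Longrightarrow> homogeneous_poly (n * d) (p ^ n)"
proof (induction n)
  case 0
  then show ?case using homogeneous_poly_const[of 1] by (simp add: const_poly_def)
next
  case (Suc n)
  then show ?case using homogeneous_poly_mult by auto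
qed


section \<open>Polynomials are determined by their values\<close>

text \<open>Induction on the set of variables: for fixed values of the other variables the sum is a
  polynomial in the variable \<open>a\<close>, so each of its coefficients vanishes, and the coefficients are sums
  of the same kind in fewer variables.\<close>

lemma monomials_independent:
  fixes c :: "('v \<Rightarrow> nat) \<Rightarrow> complex"
  assumes "finite V" "finite K"
    and "\<And>x. (\<Sum>m\<in>K. c m * (\<Prod>v\<in>V. x v ^ m v)) = 0"
    and "\<And>m m'. \<lbrakk>m \<in> K; m' \<in> K; \<forall>v\<in>V. m v = m' v\<rbrakk> \<Longrightarrow> m = m'"
  shows "\<forall>m\<in>K. c m = 0"
  using assms
proof (induction V arbitrary: K rule: finite_induct)
  case empty
  show ?case
  proof
    fix m assume "m \<in> K"
    then have "K = {m}" using empty.prems(3) by auto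
    then show "c m = 0" using empty.prems(2) by simp
  qed
next
  case (insert a V)
  have sub: "\<forall>m\<in>{m \<in> K. m a = n}. c m = 0" for n
  proof (rule insert.IH)
    show "finite {m \<in> K. m a = n}" using insert.prems by simp
    show "m = m'" if "m \<in> {m \<in> K. m a = n}" "m' \<in> {m \<in> K. m a = n}" "\<forall>v\<in>V. m v = m' v" for m m'
      using that insert.prems(3) by simp
    fix x :: "'v \<Rightarrow> complex"
    define P where "P = (\<Sum>m\<in>K. monom (c m * (\<Prod>v\<in>V. x v ^ m v)) (m a))"
    have "poly P s = 0" for s
    proof -
      have "poly P s = (\<Sum>m\<in>K. c m * (\<Prod>v\<in>insert a V. (x(a := s)) v ^ m v))"
        unfolding P_def poly_sum
      proof (rule sum.cong[OF refl])
        fix m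
        have "(\<Prod>v\<in>V. (x(a := s)) v ^ m v) = (\<Prod>v\<in>V. x v ^ m v)"
          by (rule prod.cong) (use insert.hyps in auto)
        then show "poly (monom (c m * (\<Prod>v\<in>V. x v ^ m v)) (m a)) s
            = c m * (\<Prod>v\<in>insert a V. (x(a := s)) v ^ m v)"
          using insert.hyps by (simp add: poly_monom mult_ac)
      qed
      then show ?thesis using insert.prems(2) by simp
    qed
    then have "P = 0" using poly_all_0_iff_0 by blast
    then have "coeff P n = 0" by simp
    then show "(\<Sum>m\<in>{m \<in> K. m a = n}. c m * (\<Prod>v\<in>V. x v ^ m v)) = 0"
      using insert.prems(1)
      by (simp add: P_def coeff_sum if_distrib sum.inter_filter cong: if_cong)
  qed
  then show ?case by auto
qed

lemma eval_poly_zeroD: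
  assumes "\<And>x. eval_poly p x = 0" shows "p = 0"
proof -
  let ?l = "Poly_Mapping.lookup :: ((3 \<times> 3 \<times> 3) \<Rightarrow>\<^sub>0 nat) \<Rightarrow> _"
  let ?K = "?l ` Poly_Mapping.keys p"
  have inj: "inj_on ?l A" for A
    by (simp add: inj_on_def poly_mapping.lookup_inject)
  define c where "c f = Poly_Mapping.lookup p (Poly_Mapping.Abs_poly_mapping f)" for f
  have cl: "c (?l m) = Poly_Mapping.lookup p m" for m
    by (simp add: c_def)
  have "\<forall>f\<in>?K. c f = 0"
  proof (rule monomials_independent[of UNIV])
    fix x :: "3 \<times> 3 \<times> 3 \<Rightarrow> complex"
    let ?x = "(\<chi> i j k. x (i, j, k)) :: array"
    have "(\<Sum>f\<in>?K. c f * (\<Prod>v\<in>UNIV. x v ^ f v))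
        = (\<Sum>m\<in>Poly_Mapping.keys p. Poly_Mapping.lookup p m * monom_value ?x m)"
      by (simp add: sum.reindex[OF inj] cl monom_value_def case_prod_unfold)
    also have "\<dots> = eval_poly p ?x"
      by (simp add: eval_poly_superset[of "Poly_Mapping.keys p"])
    finally show "(\<Sum>f\<in>?K. c f * (\<Prod>v\<in>UNIV. x v ^ f v)) = 0"
      using assms by simp
  qed auto
  then have "Poly_Mapping.lookup p m = 0" if "m \<in> Poly_Mapping.keys p" for m
    using cl that by force
  then show ?thesis
    by (intro poly_mapping_eqI) (metis in_keys_iff lookup_zero)
qed

lemma eval_poly_inject: "(\<And>x. eval_poly p x = eval_poly q x) \<Longrightarrow> p = q"
  using eval_poly_zeroD[of "p - q"] by simp

section \<open>The action of triples of invertible matrices\<close>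

lemma sum3_triples:
  fixes h :: "'a::finite \<Rightarrow> 'b::finite \<Rightarrow> 'c::finite \<Rightarrow> complex"
  shows "(\<Sum>p\<in>UNIV. \<Sum>q\<in>UNIV. \<Sum>r\<in>UNIV. h p q r) = (\<Sum>(p, q, r)\<in>UNIV. h p q r)"
  by (simp add: sum.cartesian_product flip: UNIV_Times_UNIV)

lemma sum3_swap:
  fixes f :: "'a::finite \<Rightarrow> 'b::finite \<Rightarrow> 'c::finite \<Rightarrow> 'd::finite \<Rightarrow> 'e::finite \<Rightarrow> 'f::finite \<Rightarrow> complex"
  shows "(\<Sum>p\<in>UNIV. \<Sum>q\<in>UNIV. \<Sum>r\<in>UNIV. \<Sum>i\<in>UNIV. \<Sum>j\<in>UNIV. \<Sum>k\<in>UNIV. f p q r i j k)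
    = (\<Sum>i\<in>UNIV. \<Sum>j\<in>UNIV. \<Sum>k\<in>UNIV. \<Sum>p\<in>UNIV. \<Sum>q\<in>UNIV. \<Sum>r\<in>UNIV. f p q r i j k)"
proof -
  let ?F = "\<lambda>(p, q, r) (i, j, k). f p q r i j k"
  have "(\<Sum>p\<in>UNIV. \<Sum>q\<in>UNIV. \<Sum>r\<in>UNIV. \<Sum>y\<in>UNIV. ?F (p, q, r) y) = (\<Sum>x\<in>UNIV. \<Sum>y\<in>UNIV. ?F x y)"
    by (subst sum3_triples) (simp add: case_prod_unfold)
  also have "\<dots> = (\<Sum>y\<in>UNIV. \<Sum>x\<in>UNIV. ?F x y)"
    by (rule sum.swap)
  also have "\<dots> = (\<Sum>i\<in>UNIV. \<Sum>j\<in>UNIV. \<Sum>k\<in>UNIV. \<Sum>x\<in>UNIV. ?F x (i, j, k))"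
    by (subst sum3_triples) (simp add: case_prod_unfold)
  finally show ?thesis
    by (simp add: sum3_triples case_prod_unfold)
qed

lemma sum3_product:
  fixes a :: "'a::finite \<Rightarrow> complex"
  shows "(\<Sum>i\<in>UNIV. \<Sum>j\<in>UNIV. \<Sum>k\<in>UNIV. a i * b j * c k) = sum a UNIV * sum b UNIV * sum c UNIV"
  by (simp flip: sum_distrib_left sum_distrib_right)

type_synonym mat3 = "complex ^ 3 ^ 3"

definition tact :: "mat3 \<times> mat3 \<times> mat3 \<Rightarrow> array \<Rightarrow> array"
  where "tact g x = act (fst g) (fst (snd g)) (snd (snd g)) x"

definition gmul :: "mat3 \<times> mat3 \<times> mat3 \<Rightarrow> mat3 \<times> mat3 \<times> mat3 \<Rightarrow> mat3 \<times> mat3 \<times> mat3"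
  where "gmul g h = (fst g ** fst h, fst (snd g) ** fst (snd h), snd (snd g) ** snd (snd h))"

text \<open>The only character needed: forms of degree \<open>36\<close> that are invariant under the special linear
  groups are multiplied by its twelfth power (see \<open>F_GL\<close> below).\<close>

definition gdet :: "mat3 \<times> mat3 \<times> mat3 \<Rightarrow> complex"
  where "gdet g = det (fst g) * det (fst (snd g)) * det (snd (snd g))"

definition GL :: "(mat3 \<times> mat3 \<times> mat3) set"
  where "GL = {g. gdet g \<noteq> 0}"

definition gone :: "mat3 \<times> mat3 \<times> mat3"
  where "gone = (mat 1, mat 1, mat 1)"

lemma tact_simp [simp]: "tact (A, B, C) x = act A B C x"
  by (simp add: tact_def)

lemma act_nth: "act A B C x $ p $ q $ r =
    (\<Sum>i\<in>UNIV. \<Sum>j\<in>UNIV. \<Sum>k\<in>UNIV. A $ p $ i * B $ q $ j * C $ r $ k * x $ i $ j $ k)"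
  by (simp add: act_def)

lemma act_nth_nested: "act A B C x $ p $ q $ r =
    (\<Sum>i\<in>UNIV. A $ p $ i * (\<Sum>j\<in>UNIV. B $ q $ j * (\<Sum>k\<in>UNIV. C $ r $ k * x $ i $ j $ k)))"
  by (simp add: act_nth sum_distrib_left mult.assoc)

lemma mat1_sum: "(\<Sum>j\<in>UNIV. (mat 1 :: mat3) $ i $ j * f j) = f i"
  by (simp add: mat_def if_distrib[of "\<lambda>c. c * _"] cong: if_cong)

lemma act_add: "act A B C (x + y) = act A B C x + act A B C y"
  by (rule array_eqI) (simp add: act_nth distrib_left sum.distrib)

lemma act_scale: "act A B C (scale_array c x) = scale_array c (act A B C x)"
  by (rule array_eqI) (simp add: act_nth sum_distrib_left mult_ac)

lemma tact_add: "tact g (x + y) = tact g x + tact g y"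
  by (simp add: tact_def act_add)

lemma tact_scale: "tact g (scale_array c x) = scale_array c (tact g x)"
  by (simp add: tact_def act_scale)

lemma act_compose: "act A B C (act A' B' C' x) = act (A ** A') (B ** B') (C ** C') x"
proof (rule array_eqI)
  fix p q r
  have "act A B C (act A' B' C' x) $ p $ q $ r
      = (\<Sum>i\<in>UNIV. \<Sum>j\<in>UNIV. \<Sum>k\<in>UNIV. \<Sum>l\<in>UNIV. \<Sum>m\<in>UNIV. \<Sum>n\<in>UNIV.
        A $ p $ i * B $ q $ j * C $ r $ k * (A' $ i $ l * B' $ j $ m * C' $ k $ n * x $ l $ m $ n))"
    by (simp add: act_nth sum_distrib_left)
  also have "\<dots> = (\<Sum>l\<in>UNIV. \<Sum>m\<in>UNIV. \<Sum>n\<in>UNIV.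
      (\<Sum>i\<in>UNIV. \<Sum>j\<in>UNIV. \<Sum>k\<in>UNIV.
        (A $ p $ i * A' $ i $ l) * (B $ q $ j * B' $ j $ m) * (C $ r $ k * C' $ k $ n)) * x $ l $ m $ n)"
    by (subst sum3_swap) (simp add: sum_distrib_left sum_distrib_right mult_ac)
  also have "\<dots> = act (A ** A') (B ** B') (C ** C') x $ p $ q $ r"
    by (simp only: sum3_product) (simp add: act_nth matrix_matrix_mult_def)
  finally show "act A B C (act A' B' C' x) $ p $ q $ r
    = act (A ** A') (B ** B') (C ** C') x $ p $ q $ r" .
qed

lemma tact_gmul: "tact (gmul g h) x = tact g (tact h x)"
  by (simp add: tact_def gmul_def act_compose)

lemma act_one: "act (mat 1) (mat 1) (mat 1) x = x"
  by (rule array_eqI) (simp only: act_nth_nested mat1_sum)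

lemma tact_gone [simp]: "tact gone x = x"
  by (simp add: gone_def act_one)

lemma gdet_gmul: "gdet (gmul g h) = gdet g * gdet h"
  by (simp add: gdet_def gmul_def det_mul)

lemma gdet_gone [simp]: "gdet gone = 1"
  by (simp add: gdet_def gone_def)

lemma GL_gmul: "g \<in> GL \<Longrightarrow> h \<in> GL \<Longrightarrow> gmul g h \<in> GL"
  by (simp add: GL_def gdet_gmul)

lemma GL_gone [simp]: "gone \<in> GL"
  by (simp add: GL_def)

lemma GL_inverse:
  assumes "g \<in> GL"
  obtains h where "h \<in> GL" "gmul g h = gone" "gmul h g = gone"
proof -
  obtain A B C where g: "g = (A, B, C)" by (cases g)
  have "invertible A" "invertible B" "invertible C"
    using assms by (auto simp: GL_def gdet_def g invertible_det_nz)
  then obtain A' B' C' where inv: "A ** A' = mat 1" "A' ** A = mat 1" "B ** B' = mat 1"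
      "B' ** B = mat 1" "C ** C' = mat 1" "C' ** C = mat 1"
    unfolding invertible_def by metis
  define h where "h = (A', B', C')"
  have gh: "gmul g h = gone" "gmul h g = gone"
    by (simp_all add: gmul_def g h_def gone_def inv)
  have "gdet g * gdet h = 1"
    using gdet_gmul[of g h] gh by simp
  then have "h \<in> GL" by (auto simp: GL_def)
  then show ?thesis using that gh by blast
qed

lemma tact_surj:
  assumes "g \<in> GL" obtains z where "tact g z = y"
proof -
  obtain h where h: "h \<in> GL" "gmul g h = gone" "gmul h g = gone"
    using GL_inverse[OF assms] .
  then have "tact g (tact h y) = y" by (simp flip: tact_gmul)
  then show ?thesis by (rule that)
qed

lemma tact_polyfun:
  fixes y :: "'s \<Rightarrow> array"
  assumes "\<And>i j k. (\<lambda>s. y s $ i $ j $ k) \<in> polyfuns C"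
  shows "(\<lambda>s. tact g (y s) $ i $ j $ k) \<in> polyfuns C"
  by (simp add: tact_def act_nth) (intro polyfuns_sum polyfuns_intros assms)

lemma polyfun_array_compose:
  fixes y :: "'s \<Rightarrow> array"
  assumes "f \<in> polyfuns entries" "\<And>i j k. (\<lambda>s. y s $ i $ j $ k) \<in> polyfuns C"
  shows "(\<lambda>s. f (y s)) \<in> polyfuns C"
  by (rule polyfuns_compose[OF assms(1)]) (auto simp: entries_def intro: assms(2))

lemma unit_array_nth: "unit_array i j k $ p $ q $ r = (if p = i \<and> q = j \<and> r = k then 1 else 0)"
  by (simp add: unit_array_def)


section \<open>Arrays whose hyperplane is tangent to the Segre variety\<close>

definition trilinear :: "array \<Rightarrow> complex ^ 3 \<Rightarrow> complex ^ 3 \<Rightarrow> complex ^ 3 \<Rightarrow> complex"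
  where "trilinear x u v w =
    (\<Sum>i\<in>UNIV. \<Sum>j\<in>UNIV. \<Sum>k\<in>UNIV. x $ i $ j $ k * (u $ i * v $ j * w $ k))"

text \<open>The hyperplane of \<open>x\<close> contains the tangent space of the Segre variety at \<open>a \<otimes> b \<otimes> c\<close> exactly when
  the trilinear form of \<open>x\<close> vanishes as soon as two of its arguments come from \<open>a\<close>, \<open>b\<close>, \<open>c\<close>. The
  zero array counts as degenerate.\<close>

definition degenerate :: "array \<Rightarrow> bool"
  where "degenerate x \<longleftrightarrow> (\<exists>a b c. a \<noteq> 0 \<and> b \<noteq> 0 \<and> c \<noteq> 0 \<and>
    (\<forall>u. trilinear x u b c = 0 \<and> trilinear x a u c = 0 \<and> trilinear x a b u = 0))"

lemma trilinear_0: "trilinear x 0 v w = 0" "trilinear x u 0 w = 0" "trilinear x u v 0 = 0"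
  by (simp_all add: trilinear_def)

lemma in_hyperplane_tangent:
  "tensor u b c + tensor a v c + tensor a b w \<in> hyperplane x \<longleftrightarrow>
    trilinear x u b c + trilinear x a v c + trilinear x a b w = 0"
  by (simp add: hyperplane_def tensor_def trilinear_def distrib_left sum.distrib)

lemma tangent_hyperplanes_iff: "x \<in> tangent_hyperplanes \<longleftrightarrow> x \<noteq> 0 \<and> degenerate x"
proof -
  have "segre_tangent a b c \<subseteq> hyperplane x \<longleftrightarrow>
      (\<forall>u. trilinear x u b c = 0 \<and> trilinear x a u c = 0 \<and> trilinear x a b u = 0)" for a b c
  proof
    assume sub: "segre_tangent a b c \<subseteq> hyperplane x"
    have eq: "trilinear x u b c + trilinear x a v c + trilinear x a b w = 0" for u v w
    proof -
      have "tensor u b c + tensor a v c + tensor a b w \<in> segre_tangent a b c"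
        by (auto simp: segre_tangent_def)
      then show ?thesis using sub in_hyperplane_tangent by blast
    qed
    show "\<forall>u. trilinear x u b c = 0 \<and> trilinear x a u c = 0 \<and> trilinear x a b u = 0"
    proof
      fix u
      show "trilinear x u b c = 0 \<and> trilinear x a u c = 0 \<and> trilinear x a b u = 0"
        using eq[of u 0 0] eq[of 0 u 0] eq[of 0 0 u] by (simp add: trilinear_0)
    qed
  next
    assume "\<forall>u. trilinear x u b c = 0 \<and> trilinear x a u c = 0 \<and> trilinear x a b u = 0"
    then show "segre_tangent a b c \<subseteq> hyperplane x"
      by (auto simp: segre_tangent_def in_hyperplane_tangent)
  qed
  then show ?thesis
    by (simp add: tangent_hyperplanes_def degenerate_def)
qed

lemma trilinear_act:
  "trilinear (act A B C x) u v w = trilinear x (u v* A) (v v* B) (w v* C)"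
proof -
  have "trilinear (act A B C x) u v w
      = (\<Sum>p\<in>UNIV. \<Sum>q\<in>UNIV. \<Sum>r\<in>UNIV. \<Sum>i\<in>UNIV. \<Sum>j\<in>UNIV. \<Sum>k\<in>UNIV.
        A $ p $ i * B $ q $ j * C $ r $ k * x $ i $ j $ k * (u $ p * v $ q * w $ r))"
    by (simp add: trilinear_def act_nth sum_distrib_right)
  also have "\<dots> = (\<Sum>i\<in>UNIV. \<Sum>j\<in>UNIV. \<Sum>k\<in>UNIV. x $ i $ j $ k *
      (\<Sum>p\<in>UNIV. \<Sum>q\<in>UNIV. \<Sum>r\<in>UNIV. (A $ p $ i * u $ p) * (B $ q $ j * v $ q) * (C $ r $ k * w $ r)))"
    by (subst sum3_swap) (simp add: sum_distrib_left mult_ac)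
  also have "\<dots> = trilinear x (u v* A) (v v* B) (w v* C)"
    by (simp only: sum3_product) (simp add: trilinear_def vector_matrix_mult_def mult.commute)
  finally show ?thesis .
qed

text \<open>The trilinear form of \<open>g x\<close> is that of \<open>x\<close> composed with the transposed matrices, so the inverse
  transposes move the critical point.\<close>

lemma degenerate_tact:
  assumes "g \<in> GL" "degenerate x" shows "degenerate (tact g x)"
proof -
  obtain h where h: "h \<in> GL" "gmul g h = gone" "gmul h g = gone"
    using GL_inverse[OF assms(1)] .
  obtain A B C A' B' C' where gh: "g = (A, B, C)" "h = (A', B', C')"
    by (cases g, cases h)
  have inv: "A' ** A = mat 1" "B' ** B = mat 1" "C' ** C = mat 1"
    "A ** A' = mat 1" "B ** B' = mat 1" "C ** C' = mat 1"
    using h(2,3) by (simp_all add: gh gmul_def gone_def)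
  obtain a b c where abc: "a \<noteq> 0" "b \<noteq> 0" "c \<noteq> 0"
    "\<And>u. trilinear x u b c = 0" "\<And>u. trilinear x a u c = 0" "\<And>u. trilinear x a b u = 0"
    using assms(2) unfolding degenerate_def by blast
  have ret: "(a v* A') v* A = a" "(b v* B') v* B = b" "(c v* C') v* C = c"
    by (simp_all add: vector_matrix_mul_assoc inv)
  have "a v* A' \<noteq> 0" "b v* B' \<noteq> 0" "c v* C' \<noteq> 0"
    using ret abc(1-3) by auto
  then show ?thesis
    unfolding degenerate_def tact_simp gh trilinear_act
    by (intro exI[of _ "a v* A'"] exI[of _ "b v* B'"] exI[of _ "c v* C'"]) (simp add: ret abc)
qed

text \<open>The point of tangency is \<open>e\<^sub>i \<otimes> e\<^sub>i \<otimes> e\<^sub>i\<close>.\<close>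

lemma degenerate_axis:
  assumes "\<And>p. x $ p $ i $ i = 0" "\<And>p. x $ i $ p $ i = 0" "\<And>p. x $ i $ i $ p = 0"
  shows "degenerate x"
proof -
  have "trilinear x u (axis i 1) (axis i 1) = 0" "trilinear x (axis i 1) u (axis i 1) = 0"
      "trilinear x (axis i 1) (axis i 1) u = 0" for u
  proof -
    have ax: "x $ p $ q $ r * (u $ p * axis i 1 $ q * axis i 1 $ r) = 0"
      "x $ p $ q $ r * (axis i 1 $ p * u $ q * axis i 1 $ r) = 0"
      "x $ p $ q $ r * (axis i 1 $ p * axis i 1 $ q * u $ r) = 0" for p q r
      using assms by (auto simp: axis_def)
    show "trilinear x u (axis i 1) (axis i 1) = 0" "trilinear x (axis i 1) u (axis i 1) = 0"
      "trilinear x (axis i 1) (axis i 1) u = 0"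
      by (simp_all only: trilinear_def ax sum.neutral_const)
  qed
  moreover have "axis i (1::complex) \<noteq> 0" by (simp add: axis_eq_0_iff)
  ultimately show ?thesis unfolding degenerate_def by blast
qed

lemma matrix_with_first_row:
  fixes a :: "complex ^ 3"
  assumes "a \<noteq> 0" obtains A :: mat3 where "det A \<noteq> 0" "A $ 1 = a"
proof -
  have "a $ 1 \<noteq> 0 \<or> a $ 2 \<noteq> 0 \<or> a $ 3 \<noteq> 0"
    using assms by (simp add: vec_eq_iff forall_3)
  then consider "a $ 1 \<noteq> 0" | "a $ 2 \<noteq> 0" | "a $ 3 \<noteq> 0" by blast
  then show ?thesis
  proof cases
    case 1
    show ?thesis
      by (rule that[of "vector [a, vector [0, 1, 0], vector [0, 0, 1]]"])
        (use 1 in \<open>simp_all add: det_3\<close>)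
  next
    case 2
    show ?thesis
      by (rule that[of "vector [a, vector [1, 0, 0], vector [0, 0, 1]]"])
        (use 2 in \<open>simp_all add: det_3\<close>)
  next
    case 3
    show ?thesis
      by (rule that[of "vector [a, vector [1, 0, 0], vector [0, 1, 0]]"])
        (use 3 in \<open>simp_all add: det_3\<close>)
  qed
qed

text \<open>The entries of \<open>g x\<close> are the values of the trilinear form of \<open>x\<close> on the rows of the three
  matrices. Hence matrices with first rows \<open>a\<close>, \<open>b\<close>, \<open>c\<close> move the point of tangency to
  \<open>e\<^sub>1 \<otimes> e\<^sub>1 \<otimes> e\<^sub>1\<close>.\<close>

lemma degenerate_normalize:
  assumes "degenerate x"
  obtains g where "g \<in> GL" "\<And>p. tact g x $ p $ 1 $ 1 = 0" "\<And>p. tact g x $ 1 $ p $ 1 = 0"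
    "\<And>p. tact g x $ 1 $ 1 $ p = 0"
proof -
  obtain a b c where abc: "a \<noteq> 0" "b \<noteq> 0" "c \<noteq> 0"
    "\<And>u. trilinear x u b c = 0" "\<And>u. trilinear x a u c = 0" "\<And>u. trilinear x a b u = 0"
    using assms unfolding degenerate_def by blast
  obtain A B C :: mat3 where A: "det A \<noteq> 0" "A $ 1 = a" and B: "det B \<noteq> 0" "B $ 1 = b"
    and C: "det C \<noteq> 0" "C $ 1 = c"
    using matrix_with_first_row abc(1-3) by metis
  have tri: "tact (A, B, C) x $ p $ q $ r = trilinear x (A $ p) (B $ q) (C $ r)" for p q r
    by (simp add: act_nth trilinear_def mult_ac)
  show ?thesis
    by (rule that[of "(A, B, C)"])
      (simp_all only: tri A(2) B(2) C(2) abc, simp add: GL_def gdet_def A B C)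
qed

section \<open>Diagonal matrices and cyclic shifts\<close>

definition dmat :: "complex ^ 3 \<Rightarrow> mat3"
  where "dmat d = (\<chi> i j. if i = j then d $ i else 0)"

lemma act_dmat: "act (dmat d) (dmat e) (dmat f) x $ p $ q $ r = d $ p * e $ q * f $ r * x $ p $ q $ r"
proof -
  have D: "(\<Sum>i\<in>UNIV. dmat d $ p $ i * h i) = d $ p * h p" for d p h
    by (simp add: dmat_def if_distrib[of "\<lambda>c. c * _"] cong: if_cong)
  show ?thesis
    by (simp only: act_nth_nested D) (simp add: mult.assoc)
qed

lemma det_dmat: "det (dmat d) = d $ 1 * d $ 2 * d $ 3"
  by (simp add: det_3 dmat_def)

text \<open>Normal arrays with the coefficient of \<open>X1\<close> split into three. The resulting directions
  are transversal to the mirror \<open>a = 0\<close>: the array is degenerate if one of \<open>x\<close>, \<open>y\<close>, \<open>z\<close>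
  is zero, whereas on normal arrays only the product \<open>x y z = a\<^sup>3\<close> is visible.\<close>

definition diag_array :: "complex \<Rightarrow> complex \<Rightarrow> complex \<Rightarrow> complex \<Rightarrow> complex \<Rightarrow> array"
  where "diag_array x y z b c = scale_array x (unit_array 1 1 1) + scale_array y (unit_array 2 2 2)
    + scale_array z (unit_array 3 3 3) + scale_array b X2 + scale_array c X3"

lemma array_ext3:
  fixes x y :: array
  assumes "x$1$1$1 = y$1$1$1" "x$1$1$2 = y$1$1$2" "x$1$1$3 = y$1$1$3"
    "x$1$2$1 = y$1$2$1" "x$1$2$2 = y$1$2$2" "x$1$2$3 = y$1$2$3"
    "x$1$3$1 = y$1$3$1" "x$1$3$2 = y$1$3$2" "x$1$3$3 = y$1$3$3"
    "x$2$1$1 = y$2$1$1" "x$2$1$2 = y$2$1$2" "x$2$1$3 = y$2$1$3"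
    "x$2$2$1 = y$2$2$1" "x$2$2$2 = y$2$2$2" "x$2$2$3 = y$2$2$3"
    "x$2$3$1 = y$2$3$1" "x$2$3$2 = y$2$3$2" "x$2$3$3 = y$2$3$3"
    "x$3$1$1 = y$3$1$1" "x$3$1$2 = y$3$1$2" "x$3$1$3 = y$3$1$3"
    "x$3$2$1 = y$3$2$1" "x$3$2$2 = y$3$2$2" "x$3$2$3 = y$3$2$3"
    "x$3$3$1 = y$3$3$1" "x$3$3$2 = y$3$3$2" "x$3$3$3 = y$3$3$3"
  shows "x = y"
  using assms by (simp add: vec_eq_iff forall_3)

lemma diag_array_nth [simp]:
  "diag_array x y z b c $ 1 $ 1 $ 1 = x" "diag_array x y z b c $ 2 $ 2 $ 2 = y"
  "diag_array x y z b c $ 3 $ 3 $ 3 = z"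
  "diag_array x y z b c $ 1 $ 2 $ 3 = b" "diag_array x y z b c $ 2 $ 3 $ 1 = b"
  "diag_array x y z b c $ 3 $ 1 $ 2 = b"
  "diag_array x y z b c $ 1 $ 3 $ 2 = c" "diag_array x y z b c $ 2 $ 1 $ 3 = c"
  "diag_array x y z b c $ 3 $ 2 $ 1 = c"
  "i \<noteq> j \<Longrightarrow> diag_array x y z b c $ i $ i $ j = 0"
  "i \<noteq> j \<Longrightarrow> diag_array x y z b c $ i $ j $ i = 0"
  "i \<noteq> j \<Longrightarrow> diag_array x y z b c $ j $ i $ i = 0"
  by (auto simp: diag_array_def X2_def X3_def unit_array_nth)

lemma normal_array_diag: "normal_array a b c = diag_array a a a b c"
  by (rule array_ext3) (simp_all add: normal_array_def diag_array_def X1_def unit_array_nth)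

lemma normal_array_nth [simp]:
  "normal_array a b c $ 1 $ 1 $ 1 = a" "normal_array a b c $ 2 $ 2 $ 2 = a"
  "normal_array a b c $ 3 $ 3 $ 3 = a"
  "normal_array a b c $ 1 $ 2 $ 3 = b" "normal_array a b c $ 2 $ 3 $ 1 = b"
  "normal_array a b c $ 3 $ 1 $ 2 = b"
  "normal_array a b c $ 1 $ 3 $ 2 = c" "normal_array a b c $ 2 $ 1 $ 3 = c"
  "normal_array a b c $ 3 $ 2 $ 1 = c"
  "i \<noteq> j \<Longrightarrow> normal_array a b c $ i $ i $ j = 0"
  "i \<noteq> j \<Longrightarrow> normal_array a b c $ i $ j $ i = 0"
  "i \<noteq> j \<Longrightarrow> normal_array a b c $ j $ i $ i = 0"
  by (simp_all add: normal_array_diag)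

text \<open>The triple \<open>(1, P, P\<^sup>2)\<close> for the cyclic permutation matrix \<open>P\<close>; it permutes
  \<open>X1\<close>, \<open>X2\<close>, \<open>X3\<close> cyclically.\<close>

definition shift :: "mat3 \<times> mat3 \<times> mat3"
  where "shift = (mat 1, vector [vector [0, 0, 1], vector [1, 0, 0], vector [0, 1, 0]],
    vector [vector [0, 1, 0], vector [0, 0, 1], vector [1, 0, 0]])"

lemma shift_GL: "shift \<in> GL"
  by (simp add: shift_def GL_def gdet_def det_3 mat_def)

definition pred3 :: "3 \<Rightarrow> 3" where "pred3 i = (if i = 1 then 3 else if i = 2 then 1 else 2)"

lemma tact_shift_nth: "tact shift x $ p $ q $ r = x $ p $ pred3 q $ pred3 (pred3 r)"
proof -
  let ?P = "vector [vector [0, 0, 1], vector [1, 0, 0], vector [0, 1, 0]] :: mat3"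
  let ?Q = "vector [vector [0, 1, 0], vector [0, 0, 1], vector [1, 0, 0]] :: mat3"
  have P: "(\<Sum>i\<in>UNIV. ?P $ p $ i * f i) = f (pred3 p)" for p f
    using exhaust_3[of p] by (auto simp: sum_3 pred3_def)
  have Q: "(\<Sum>i\<in>UNIV. ?Q $ p $ i * f i) = f (pred3 (pred3 p))" for p f
    using exhaust_3[of p] by (auto simp: sum_3 pred3_def)
  show ?thesis
    unfolding shift_def tact_simp act_nth_nested by (simp only: mat1_sum P Q)
qed

lemma shift_normal: "tact shift (normal_array a b c) = normal_array c a b"
  by (rule array_ext3) (simp_all add: tact_shift_nth pred3_def)

section \<open>The finite Fourier transform\<close>

definition \<omega> :: complex where "\<omega> = Complex (- 1 / 2) (sqrt 3 / 2)"

text \<open>Used from left to right, this and the next equation bring polynomial expressions in \<open>\<omega>\<close>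
  into the form \<open>u + v \<omega>\<close>.\<close>

lemma omega_sq: "\<omega> * \<omega> = - 1 - \<omega>"
  by (simp add: \<omega>_def complex_eq_iff field_simps)

lemma omega_sq_assoc: "\<omega> * (\<omega> * z) = - z - \<omega> * z"
  using omega_sq by (metis (no_types) left_diff_distrib minus_mult_minus mult.assoc mult.left_neutral mult_minus_left)

lemma omega_cube: "\<omega> ^ 3 = 1"
  by (simp add: power3_eq_cube omega_sq algebra_simps)

lemma omega_distinct: "\<omega> \<noteq> 1" "\<omega> \<noteq> 0" "\<omega> * \<omega> \<noteq> 1" "\<omega> * \<omega> \<noteq> \<omega>"
  by (simp_all add: \<omega>_def complex_eq_iff)

definition dft :: mat3
  where "dft = vector [vector [\<omega>, \<omega> * \<omega>, 1], vector [\<omega> * \<omega>, \<omega>, 1], vector [1, 1, 1]]"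

lemma dft_nth [simp]:
  "dft $ 1 $ 1 = \<omega>" "dft $ 1 $ 2 = \<omega> * \<omega>" "dft $ 1 $ 3 = 1"
  "dft $ 2 $ 1 = \<omega> * \<omega>" "dft $ 2 $ 2 = \<omega>" "dft $ 2 $ 3 = 1"
  "dft $ 3 $ 1 = 1" "dft $ 3 $ 2 = 1" "dft $ 3 $ 3 = 1"
  by (simp_all add: dft_def)

lemma det_dft: "det dft \<noteq> 0"
  by (simp add: det_3 omega_sq omega_sq_assoc algebra_simps) (simp add: \<omega>_def complex_eq_iff)

text \<open>Read the indices modulo \<open>3\<close>. The normal arrays are the arrays that are supported on
  \<open>i + j + k = 0\<close> and invariant under the simultaneous shift of all indices; the Fourier transform
  exchanges these two conditions.\<close>

lemma dft_normal:
  "act dft dft dft (normal_array a b c) = normal_array (3 * (a + b + c))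
    (3 * (a + \<omega> * \<omega> * b + \<omega> * c)) (3 * (a + \<omega> * b + \<omega> * \<omega> * c))"
  by (rule array_ext3) (simp_all add: act_nth sum_3 omega_sq omega_sq_assoc algebra_simps)

section \<open>The twelve lines of the Hesse configuration\<close>

lemma cube_root_of_unity_cases:
  fixes x :: complex
  assumes "x ^ 3 = 1" obtains "x = 1" | "x = \<omega>" | "x = \<omega> * \<omega>"
proof -
  have "(x - 1) * ((x - \<omega>) * (x - \<omega> * \<omega>)) = x ^ 3 - 1"
    by (simp add: power3_eq_cube omega_sq omega_sq_assoc algebra_simps)
  then show ?thesis using assms that by auto
qed

text \<open>The Fourier transform followed by diagonal matrices that preserve the normal arrays. With
  \<open>z = x\<^sup>2 y\<close> and \<open>k = x y\<close> it carries the mirror \<open>a = 0\<close> to \<open>a + x b + y c = 0\<close>, for cube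
  roots of unity \<open>x\<close> and \<open>y\<close>.\<close>

definition hesse :: "complex \<Rightarrow> complex \<Rightarrow> mat3 \<times> mat3 \<times> mat3"
  where "hesse z k = gmul (dmat (vector [1, 1, k]), dmat (vector [z, z * z, k]),
    dmat (vector [z * z, z, k])) (dft, dft, dft)"

lemma hesse_GL: assumes "z ^ 3 = 1" "k ^ 3 = 1" shows "hesse z k \<in> GL"
proof -
  have "z \<noteq> 0" "k \<noteq> 0" using assms by auto
  then have "(dmat (vector [1, 1, k]), dmat (vector [z, z * z, k]), dmat (vector [z * z, z, k])) \<in> GL"
    by (simp add: GL_def gdet_def det_dmat)
  moreover have "(dft, dft, dft) \<in> GL" by (simp add: GL_def gdet_def det_dft)
  ultimately show ?thesis unfolding hesse_def by (rule GL_gmul)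
qed

lemma hesse_nth: "tact (hesse z k) x $ p $ q $ r =
    vector [1, 1, k] $ p * vector [z, z * z, k] $ q * vector [z * z, z, k] $ r
    * act dft dft dft x $ p $ q $ r"
  by (simp add: hesse_def tact_gmul act_dmat)

lemma hesse_normal:
  assumes "z ^ 3 = 1" "k ^ 3 = 1"
  shows "tact (hesse z k) (normal_array a b c) = normal_array (3 * (a + b + c))
    (z * z * k * (3 * (a + \<omega> * \<omega> * b + \<omega> * c))) (z * k * (3 * (a + \<omega> * b + \<omega> * \<omega> * c)))"
proof -
  have "z * z * z = 1" "k * k * k = 1" using assms unfolding power3_eq_cube by this+
  then show ?thesis
    by (intro array_ext3) (simp_all add: hesse_nth dft_normal mult_ac)
qed

lemma hesse_normal_inverse:
  assumes "x ^ 3 = 1" "y ^ 3 = 1"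
  shows "normal_array a b c = tact (hesse (x * x * y) (x * y))
    (normal_array ((a + x * b + y * c) / 9) ((a + \<omega> * x * b + \<omega> * \<omega> * y * c) / 9)
      ((a + \<omega> * \<omega> * x * b + \<omega> * y * c) / 9))"
proof -
  have z: "(x * x * y) ^ 3 = 1" "(x * y) ^ 3 = 1"
    using assms by (simp_all add: power_mult_distrib)
  have x: "x * x * x = 1" "y * y * y = 1"
    using assms unfolding power3_eq_cube by this+
  have zk: "x * x * y * (x * x * y) * (x * y) = x * x" "x * x * y * (x * y) = y * y"
  proof -
    have "x * x * y * (x * x * y) * (x * y) = (x * x * x) * (y * y * y) * (x * x)"
      "x * x * y * (x * y) = (x * x * x) * (y * y)"
      by (simp_all only: mult_ac)
    then show "x * x * y * (x * x * y) * (x * y) = x * x" "x * x * y * (x * y) = y * y"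
      by (simp_all add: x)
  qed
  let ?a = "(a + x * b + y * c) / 9" and ?b = "(a + \<omega> * x * b + \<omega> * \<omega> * y * c) / 9"
    and ?c = "(a + \<omega> * \<omega> * x * b + \<omega> * y * c) / 9"
  have "3 * (?a + ?b + ?c) = a"
    by (simp add: omega_sq omega_sq_assoc field_simps)
  moreover have "3 * (?a + \<omega> * \<omega> * ?b + \<omega> * ?c) = x * b"
    by (simp add: omega_sq omega_sq_assoc field_simps)
  moreover have "3 * (?a + \<omega> * ?b + \<omega> * \<omega> * ?c) = y * c"
    by (simp add: omega_sq omega_sq_assoc field_simps)
  ultimately have "tact (hesse (x * x * y) (x * y)) (normal_array ?a ?b ?c)
      = normal_array a (x * x * (x * b)) (y * y * (y * c))"
    unfolding hesse_normal[OF z] zk by presburger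
  moreover have "x * x * (x * b) = b" "y * y * (y * c) = c"
  proof -
    have "x * x * (x * b) = x * x * x * b" "y * y * (y * c) = y * y * y * c"
      by (simp_all only: mult.assoc)
    then show "x * x * (x * b) = b" "y * y * (y * c) = c" by (simp_all add: x)
  qed
  ultimately show ?thesis by simp
qed

text \<open>Coefficients of the twelve linear forms that define the Hesse lines. These are the mirrors of the
  complex reflection group of order \<open>648\<close> that the elements of
  $SL_3 \times SL_3 \times SL_3$ preserving the space of normal arrays induce on it.\<close>

definition forms :: "(complex \<times> complex \<times> complex) set"
  where "forms = {(1, 0, 0), (0, 1, 0), (0, 0, 1)} \<union> {(1, x, y) | x y. x ^ 3 = 1 \<and> y ^ 3 = 1}"

definition form :: "complex \<times> complex \<times> complex \<Rightarrow> complex \<Rightarrow> complex \<Rightarrow> complex \<Rightarrow> complex"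
  where "form l a b c = fst l * a + fst (snd l) * b + snd (snd l) * c"

text \<open>All twelve mirrors are equivalent to \<open>a = 0\<close> under matrices that preserve the space of normal
  arrays.\<close>

lemma form_frame:
  assumes "l \<in> forms"
  obtains w k m n where "w \<in> GL"
    "\<And>a b c. normal_array a b c = tact w (normal_array (k * form l a b c) (form m a b c) (form n a b c))"
proof -
  consider "l = (1, 0, 0)" | "l = (0, 1, 0)" | "l = (0, 0, 1)"
    | x y where "l = (1, x, y)" "x ^ 3 = 1" "y ^ 3 = 1"
    using assms unfolding forms_def by auto
  then show ?thesis
  proof cases
    case 1
    show ?thesis
      by (rule that[of gone 1 "(0, 1, 0)" "(0, 0, 1)"]) (simp_all add: 1 form_def)
  next
    case 2
    show ?thesis
      by (rule that[of shift 1 "(0, 0, 1)" "(1, 0, 0)"])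
        (simp_all add: 2 form_def shift_GL shift_normal)
  next
    case 3
    show ?thesis
      by (rule that[of "gmul shift shift" 1 "(1, 0, 0)" "(0, 1, 0)"])
        (simp_all add: 3 form_def shift_GL GL_gmul tact_gmul shift_normal)
  next
    case 4
    have "(x * x * y) ^ 3 = 1" "(x * y) ^ 3 = 1"
      using 4 by (simp_all add: power_mult_distrib)
    from hesse_GL[OF this] show ?thesis
    proof (rule that[of _ "1/9" "(1/9, \<omega> * x / 9, \<omega> * \<omega> * y / 9)" "(1/9, \<omega> * \<omega> * x / 9, \<omega> * y / 9)"])
      show "normal_array a b c = tact (hesse (x * x * y) (x * y)) (normal_array (1 / 9 * form l a b c)
          (form (1/9, \<omega> * x / 9, \<omega> * \<omega> * y / 9) a b c)
          (form (1/9, \<omega> * \<omega> * x / 9, \<omega> * y / 9) a b c))" for a b c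
        using hesse_normal_inverse[OF 4(2,3), of a b c]
        by (simp add: 4 form_def add_divide_distrib)
    qed
  qed
qed

lemma cube_roots_of_unity: "{x :: complex. x ^ 3 = 1} = {1, \<omega>, \<omega> * \<omega>}"
proof (rule set_eqI)
  fix x :: complex
  have "\<omega> ^ 3 = 1" "(\<omega> * \<omega>) ^ 3 = 1" by (simp_all add: power_mult_distrib omega_cube)
  then show "x \<in> {x. x ^ 3 = 1} \<longleftrightarrow> x \<in> {1, \<omega>, \<omega> * \<omega>}"
    using cube_root_of_unity_cases[of x] by auto
qed

lemma prod_cube_roots: "(\<Prod>x | x ^ 3 = 1. f x) = f 1 * f \<omega> * f (\<omega> * \<omega>)" for f :: "complex \<Rightarrow> 'a::comm_monoid_mult"
  using omega_distinct by (simp add: cube_roots_of_unity mult_ac) 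

lemma forms_split:
  "forms = insert (1, 0, 0) (insert (0, 1, 0) (insert (0, 0, 1)
    ((\<lambda>(x, y). (1, x, y)) ` ({x. x ^ 3 = 1} \<times> {y. y ^ 3 = 1}))))"
  unfolding forms_def by auto

lemma finite_forms: "finite forms"
  unfolding forms_split cube_roots_of_unity by simp

lemma prod_forms: "(\<Prod>l\<in>forms. f l) = f (1, 0, 0) * f (0, 1, 0) * f (0, 0, 1) *
    (\<Prod>x | x ^ 3 = 1. \<Prod>y | y ^ 3 = 1. f (1, x, y))" for f :: "_ \<Rightarrow> 'a::comm_monoid_mult"
proof -
  let ?S = "(\<lambda>(x, y). (1, x, y)) ` ({x. x ^ 3 = 1} \<times> {y. y ^ 3 = 1}) :: (complex \<times> complex \<times> complex) set"
  have fin: "finite ?S" by (simp add: cube_roots_of_unity)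
  have "(\<Prod>l\<in>?S. f l) = (\<Prod>(x, y)\<in>{x. x ^ 3 = 1} \<times> {y. y ^ 3 = 1}. f (1, x, y))"
    by (subst prod.reindex) (auto simp: inj_on_def case_prod_unfold)
  also have "\<dots> = (\<Prod>x | x ^ 3 = 1. \<Prod>y | y ^ 3 = 1. f (1, x, y))"
    by (simp add: prod.cartesian_product)
  finally have S: "(\<Prod>l\<in>?S. f l) = \<dots>" .
  have "(0, 1, 0) \<notin> ?S" "(0, 0, 1) \<notin> ?S" "(1, 0, 0) \<notin> ?S" by auto
  then show ?thesis
    unfolding forms_split using fin by (simp add: S[simplified] mult_ac)
qed

lemma card_forms: "card forms = 12"
proof -
  have "finite {x :: complex. x ^ 3 = 1}" "card {x :: complex. x ^ 3 = 1} = 3"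
    using omega_distinct by (simp_all add: cube_roots_of_unity)
  then have "2 ^ card forms = (2 :: nat) ^ 12"
    using prod_forms[of "\<lambda>_. 2 :: nat"] by (simp add: finite_forms)
  then show ?thesis by (simp only: power_inject_exp one_less_numeral_iff semiring_norm)
qed

text \<open>The product over \<open>y\<close> is \<open>(a + x b)\<^sup>3 + c\<^sup>3\<close>. The product of these over \<open>x\<close> is the norm
  \<open>A\<^sup>3 + B\<^sup>3 + C\<^sup>3 - 3 A B C\<close> with \<open>A = a\<^sup>3 + b\<^sup>3 + c\<^sup>3\<close>, \<open>B = 3 a\<^sup>2 b\<close>,
  \<open>C = 3 a b\<^sup>2\<close>.\<close>

lemma prod_forms_value:
  "(\<Prod>l\<in>forms. form l a b c) =
    a * b * c * ((a ^ 3 + b ^ 3 + c ^ 3) ^ 3 - 27 * (a * b * c) ^ 3)"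
proof -
  have y: "(\<Prod>y | y ^ 3 = 1. form (1, x, y) a b c) = (a + x * b) ^ 3 + c ^ 3" for x
    unfolding prod_cube_roots
    by (simp add: form_def power3_eq_cube omega_sq omega_sq_assoc algebra_simps)
  have x: "(a + \<omega> * b) ^ 3 + c ^ 3 = (a ^ 3 + b ^ 3 + c ^ 3) + \<omega> * (3 * a^2 * b) + (\<omega> * \<omega>) * (3 * a * b^2)"
    "(a + (\<omega> * \<omega>) * b) ^ 3 + c ^ 3 = (a ^ 3 + b ^ 3 + c ^ 3) + (\<omega> * \<omega>) * (3 * a^2 * b) + \<omega> * (3 * a * b^2)"
    by (simp_all add: power3_eq_cube power2_eq_square omega_sq omega_sq_assoc algebra_simps)
  have norm: "(A + B + C) * (A + \<omega> * B + (\<omega> * \<omega>) * C) * (A + (\<omega> * \<omega>) * B + \<omega> * C)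
      = A ^ 3 + B ^ 3 + C ^ 3 - 3 * A * B * C" for A B C
    by (simp add: power3_eq_cube omega_sq omega_sq_assoc algebra_simps)
  have "(\<Prod>x | x ^ 3 = 1. \<Prod>y | y ^ 3 = 1. form (1, x, y) a b c)
      = ((a ^ 3 + b ^ 3 + c ^ 3) + (3 * a^2 * b) + (3 * a * b^2))
        * ((a ^ 3 + b ^ 3 + c ^ 3) + \<omega> * (3 * a^2 * b) + (\<omega> * \<omega>) * (3 * a * b^2))
        * ((a ^ 3 + b ^ 3 + c ^ 3) + (\<omega> * \<omega>) * (3 * a^2 * b) + \<omega> * (3 * a * b^2))"
    unfolding y prod_cube_roots x by (simp add: power3_eq_cube power2_eq_square algebra_simps)
  also have "\<dots> = (a ^ 3 + b ^ 3 + c ^ 3) ^ 3 - 27 * (a * b * c) ^ 3"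
    unfolding norm by (simp add: power2_eq_square power3_eq_cube algebra_simps)
  finally show ?thesis
    unfolding prod_forms by (simp add: form_def)
qed

text \<open>The first nonzero coefficient of each of the forms is \<open>1\<close>, so different forms are not
  proportional; the cross products of their coefficient vectors do not vanish.\<close>

lemma forms_independent:
  assumes "l \<in> forms" "m \<in> forms" "l \<noteq> m"
  shows "fst l * fst (snd m) \<noteq> fst m * fst (snd l) \<or> fst l * snd (snd m) \<noteq> fst m * snd (snd l)
    \<or> fst (snd l) * snd (snd m) \<noteq> fst (snd m) * snd (snd l)"
  using assms unfolding forms_def by auto


section \<open>Spanning the space of arrays\<close>

definition pairing :: "array \<Rightarrow> array \<Rightarrow> complex"
  where "pairing m y = (\<Sum>i\<in>UNIV. \<Sum>j\<in>UNIV. \<Sum>k\<in>UNIV. m $ i $ j $ k * y $ i $ j $ k)"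

definition frames :: "(mat3 \<times> mat3 \<times> mat3) set"
  where "frames = {gone, shift, gmul shift shift} \<union> {hesse z k | z k. z ^ 3 = 1 \<and> k ^ 3 = 1}"

lemma fourier_unique3:
  fixes A B C :: complex
  assumes "\<And>s. s ^ 3 = 1 \<Longrightarrow> A + s * B + s * s * C = 0"
  shows "A = 0" "B = 0" "C = 0"
proof -
  have "A + B + C = 0" "A + \<omega> * B + \<omega> * \<omega> * C = 0" "A + \<omega> * \<omega> * B + \<omega> * C = 0"
  proof -
    have "(\<omega> * \<omega>) ^ 3 = 1" by (simp only: power_mult_distrib omega_cube) simp
    from assms[OF this] show "A + \<omega> * \<omega> * B + \<omega> * C = 0"
      by (simp add: omega_sq omega_sq_assoc algebra_simps)
    show "A + B + C = 0" "A + \<omega> * B + \<omega> * \<omega> * C = 0"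
      using assms[of 1] assms[OF omega_cube] by simp_all
  qed
  moreover have "1 + \<omega> + \<omega> * \<omega> = 0" by (simp add: omega_sq)
  ultimately have "3 * A = 0" "3 * B = 0" "3 * C = 0" by algebra+
  then show "A = 0" "B = 0" "C = 0" by auto
qed

lemma pairing_unit: "pairing m (unit_array p q r) = m $ p $ q $ r"
proof -
  define \<delta> :: "3 \<Rightarrow> 3 \<Rightarrow> complex" where "\<delta> p i = (if i = p then 1 else 0)" for p i
  have D: "(\<Sum>i\<in>UNIV. \<delta> p i * f i) = f p" for p f
    by (simp add: \<delta>_def if_distrib[of "\<lambda>c. c * _"] cong: if_cong)
  have e: "m $ i $ j $ k * unit_array p q r $ i $ j $ k
      = \<delta> p i * (\<delta> q j * (\<delta> r k * m $ i $ j $ k))" for i j k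
    by (auto simp: unit_array_nth \<delta>_def)
  have "pairing m (unit_array p q r)
      = (\<Sum>i\<in>UNIV. \<delta> p i * (\<Sum>j\<in>UNIV. \<delta> q j * (\<Sum>k\<in>UNIV. \<delta> r k * m $ i $ j $ k)))"
    unfolding pairing_def e by (simp add: sum_distrib_left)
  then show ?thesis by (simp only: D)
qed

lemma shift_unit:
  "tact shift (unit_array 1 1 1) = unit_array 1 2 3" "tact shift (unit_array 2 2 2) = unit_array 2 3 1"
  "tact shift (unit_array 3 3 3) = unit_array 3 1 2"
  "tact shift (unit_array 1 2 3) = unit_array 1 3 2" "tact shift (unit_array 2 3 1) = unit_array 2 1 3"
  "tact shift (unit_array 3 1 2) = unit_array 3 2 1"
  by (rule array_ext3; simp add: tact_shift_nth unit_array_nth pred3_def)+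

text \<open>The first three frames move the diagonal units to the \<open>9\<close> units with \<open>i + j + k = 0\<close> modulo
  \<open>3\<close>. The others move them to the tensors
  \<open>(s, s\<^sup>2, k) \<otimes> (z s, z\<^sup>2 s\<^sup>2, k) \<otimes> (z\<^sup>2 s, z s\<^sup>2, k)\<close> with cube roots of unity
  \<open>s\<close>, \<open>z\<close>, \<open>k\<close>. In the pairing with such a tensor each of the \<open>18\<close> remaining entries of \<open>m\<close>
  carries its own character of \<open>(s, z, k)\<close>, so Fourier inversion in the three variables isolates it.\<close>

lemma frames_span:
  assumes "\<And>w i. w \<in> frames \<Longrightarrow> pairing m (tact w (unit_array i i i)) = 0"
  shows "m = 0"
proof -
  have code0: "m $ p $ p $ p = 0" for p
    using assms[of gone p] by (simp add: frames_def pairing_unit)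
  have code1: "m $ 1 $ 2 $ 3 = 0" "m $ 2 $ 3 $ 1 = 0" "m $ 3 $ 1 $ 2 = 0"
    using assms[of shift 1] assms[of shift 2] assms[of shift 3]
    by (simp_all add: frames_def shift_unit pairing_unit)
  have code2: "m $ 1 $ 3 $ 2 = 0" "m $ 2 $ 1 $ 3 = 0" "m $ 3 $ 2 $ 1 = 0"
    using assms[of "gmul shift shift" 1] assms[of "gmul shift shift" 2]
      assms[of "gmul shift shift" 3]
    by (simp_all add: frames_def tact_gmul shift_unit pairing_unit)
  note code = code0 code1 code2
  \<comment> \<open>\<open>Bcd\<close> collects the entries that carry the character \<open>s\<^sup>c z\<^sup>d\<close>.\<close>
  define B10 where "B10 k = m $ 2 $ 1 $ 1 + k * m $ 3 $ 2 $ 2 + k * k * m $ 1 $ 3 $ 3" for k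
  define B11 where "B11 k = m $ 1 $ 2 $ 1 + k * m $ 2 $ 3 $ 2 + k * k * m $ 3 $ 1 $ 3" for k
  define B12 where "B12 k = m $ 1 $ 1 $ 2 + k * m $ 2 $ 2 $ 3 + k * k * m $ 3 $ 3 $ 1" for k
  define B20 where "B20 k = m $ 1 $ 2 $ 2 + k * m $ 3 $ 1 $ 1 + k * k * m $ 2 $ 3 $ 3" for k
  define B21 where "B21 k = m $ 2 $ 2 $ 1 + k * m $ 1 $ 1 $ 3 + k * k * m $ 3 $ 3 $ 2" for k
  define B22 where "B22 k = m $ 2 $ 1 $ 2 + k * m $ 1 $ 3 $ 1 + k * k * m $ 3 $ 2 $ 3" for k
  note B_defs = B10_def B11_def B12_def B20_def B21_def B22_def
  have cols: "act dft dft dft (unit_array i i i) $ p $ q $ r = dft $ p $ i * dft $ q $ i * dft $ r $ i" for i p q r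
    using exhaust_3[of i] by (auto simp: act_nth unit_array_nth sum_3)
  have cube: "t * (t * t) = 1" "t * (t * (t * u)) = u" if "t ^ 3 = 1" for t u :: complex
  proof -
    have "t * (t * t) = 1" using that by (simp add: power3_eq_cube mult.assoc)
    moreover have "t * (t * (t * u)) = t * (t * t) * u" by (simp only: mult.assoc)
    ultimately show "t * (t * t) = 1" "t * (t * (t * u)) = u" by simp_all
  qed
  have T: "0 + s * (B10 k + z * B11 k + z * z * B12 k) + s * s * (B20 k + z * B21 k + z * z * B22 k) = 0"
    if s: "s ^ 3 = 1" and z: "z ^ 3 = 1" and k: "k ^ 3 = 1" for s z k
  proof -
    have "\<exists>i. \<forall>p. dft $ p $ i = vector [s, s * s, 1] $ p"
      using s
    proof (rule cube_root_of_unity_cases)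
      show ?thesis if "s = 1" by (rule exI[of _ 3]) (simp add: that forall_3)
      show ?thesis if "s = \<omega>" by (rule exI[of _ 1]) (simp add: that forall_3)
      show ?thesis if "s = \<omega> * \<omega>"
        by (rule exI[of _ 2]) (simp add: that forall_3 omega_sq omega_sq_assoc algebra_simps)
    qed
    then obtain i where i: "\<And>p. dft $ p $ i = vector [s, s * s, 1] $ p" by blast
    have "0 = pairing m (tact (hesse z k) (unit_array i i i))"
      using assms[of "hesse z k"] z k by (auto simp: frames_def)
    also have "\<dots> = s * (B10 k + z * B11 k + z * z * B12 k) + s * s * (B20 k + z * B21 k + z * z * B22 k)"
      unfolding pairing_def sum_3 hesse_nth cols i B_defs
      by (simp add: code cube[OF s] cube[OF z] cube[OF k] algebra_simps)
    finally show ?thesis by simp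
  qed
  have B1: "B10 k + z * B11 k + z * z * B12 k = 0" "B20 k + z * B21 k + z * z * B22 k = 0"
    if "z ^ 3 = 1" "k ^ 3 = 1" for z k
    using fourier_unique3(2,3)[OF T[OF _ that]] by auto
  have B2: "B10 k = 0" "B11 k = 0" "B12 k = 0" "B20 k = 0" "B21 k = 0" "B22 k = 0" if "k ^ 3 = 1" for k
    using fourier_unique3[OF B1(1)[OF _ that]] fourier_unique3[OF B1(2)[OF _ that]] by auto
  note B3 = B2[unfolded B_defs]
  note B4 = fourier_unique3[OF B3(1)] fourier_unique3[OF B3(2)] fourier_unique3[OF B3(3)]
    fourier_unique3[OF B3(4)] fourier_unique3[OF B3(5)] fourier_unique3[OF B3(6)]
  show ?thesis
    by (rule array_ext3) (simp_all add: code B4)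
qed

section \<open>The torus and the normal slice\<close>

lemma det_cube_root:
  fixes A :: mat3
  assumes "det A \<noteq> 0"
  obtains s B where "det B = 1" "s ^ 3 = det A" "A = (\<chi> i j. s * B $ i $ j)"
proof -
  obtain s where s: "det A = s ^ 3"
    using exists_complex_root[of 3 "det A"] by auto
  have "s \<noteq> 0" using s assms by auto
  define B :: mat3 where "B = (\<chi> i j. A $ i $ j / s)"
  have A: "A = (\<chi> i j. s * B $ i $ j)"
    using \<open>s \<noteq> 0\<close> by (simp add: B_def vec_eq_iff)
  have "det A = s ^ 3 * det B"
    by (subst A) (simp add: det_3 power3_eq_cube algebra_simps)
  then have "det B = 1" using s assms by auto
  then show ?thesis using that s A by metis
qed

lemma act_scale_matrices:
  "act (\<chi> i j. r * A $ i $ j) (\<chi> i j. s * B $ i $ j) (\<chi> i j. t * C $ i $ j) x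
    = scale_array (r * s * t) (act A B C x)"
  by (rule array_eqI) (simp add: act_nth sum_distrib_left mult_ac)

definition torus :: "complex \<Rightarrow> complex \<Rightarrow> complex \<Rightarrow> mat3 \<times> mat3 \<times> mat3"
  where "torus \<alpha> \<beta> \<gamma> = (dmat (vector [\<alpha>, \<beta>, \<gamma>]), dmat (vector [\<alpha>, \<beta>, \<gamma>]), dmat (vector [\<alpha>, \<beta>, \<gamma>]))"

lemma gdet_torus: "gdet (torus \<alpha> \<beta> \<gamma>) = (\<alpha> * \<beta> * \<gamma>) ^ 3"
  by (simp add: gdet_def torus_def det_dmat power3_eq_cube)

lemma torus_nth: "tact (torus \<alpha> \<beta> \<gamma>) x $ p $ q $ r =
    vector [\<alpha>, \<beta>, \<gamma>] $ p * vector [\<alpha>, \<beta>, \<gamma>] $ q * vector [\<alpha>, \<beta>, \<gamma>] $ r * x $ p $ q $ r"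
  by (simp add: torus_def act_dmat)

text \<open>This torus moves a normal array within the slice of the arrays \<open>diag_array\<close>, preserving the
  product of the three diagonal coefficients.\<close>

lemma torus_normal:
  assumes "\<alpha> * \<beta> * \<gamma> = 1"
  shows "tact (torus \<alpha> \<beta> \<gamma>) (normal_array a b c) = diag_array (\<alpha> ^ 3 * a) (\<beta> ^ 3 * a) (\<gamma> ^ 3 * a) b c"
proof -
  have "\<alpha> * \<beta> * \<gamma> * u = u" "\<alpha> * \<gamma> * \<beta> * u = u" "\<beta> * \<alpha> * \<gamma> * u = u" "\<beta> * \<gamma> * \<alpha> * u = u"
    "\<gamma> * \<alpha> * \<beta> * u = u" "\<gamma> * \<beta> * \<alpha> * u = u" for u
    using assms by (simp_all add: mult_ac)
  then show ?thesis
    by (intro array_ext3) (simp_all add: torus_nth power3_eq_cube)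
qed

lemma degenerate_diag:
  assumes "x = 0 \<or> y = 0 \<or> z = 0" shows "degenerate (diag_array x y z b c)"
proof -
  have "\<exists>i. diag_array x y z b c $ i $ i $ i = 0" using assms by (metis diag_array_nth(1-3))
  then obtain i where i: "diag_array x y z b c $ i $ i $ i = 0" by blast
  show ?thesis
    by (rule degenerate_axis[of _ i]) (metis i diag_array_nth(10-12))+
qed

lemma linear_pairing:
  fixes L :: "array \<Rightarrow> complex"
  assumes "\<And>x y. L (x + y) = L x + L y" "\<And>c x. L (scale_array c x) = c * L x"
  shows "L y = pairing (\<chi> i j k. L (unit_array i j k)) y"
proof -
  have L0: "L 0 = 0"
  proof -
    have "scale_array 0 0 = (0 :: array)" by (rule array_eqI) simp
    then show ?thesis using assms(2)[of 0 0] by simp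
  qed
  have Lsum: "L (sum g A) = (\<Sum>a\<in>A. L (g a))" if "finite A" for A :: "3 set" and g
    using that by (induction A rule: finite_induct) (auto simp: L0 assms(1))
  have "y = (\<Sum>i\<in>UNIV. \<Sum>j\<in>UNIV. \<Sum>k\<in>UNIV. scale_array (y $ i $ j $ k) (unit_array i j k))"
    by (rule array_ext3) (simp_all add: sum_3 unit_array_nth)
  then have "L y = L (\<Sum>i\<in>UNIV. \<Sum>j\<in>UNIV. \<Sum>k\<in>UNIV. scale_array (y $ i $ j $ k) (unit_array i j k))"
    by simp
  also have "\<dots> = pairing (\<chi> i j k. L (unit_array i j k)) y"
    by (simp add: Lsum assms(2) pairing_def mult.commute)
  finally show ?thesis .
qed

lemma frames_GL: "w \<in> frames \<Longrightarrow> w \<in> GL"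
  unfolding frames_def using shift_GL GL_gmul[OF shift_GL shift_GL] hesse_GL by auto

lemma frames_normal:
  assumes "w \<in> frames"
  obtains a' b' c' where "normal_array a b c = tact w (normal_array a' b' c')"
proof -
  consider "w = gone" | "w = shift" | "w = gmul shift shift"
    | z k where "w = hesse z k" "z ^ 3 = 1" "k ^ 3 = 1"
    using assms unfolding frames_def by auto
  then show ?thesis
  proof cases
    case 1
    then show ?thesis using that[of a b c] by simp
  next
    case 2
    then show ?thesis using that[of b c a] by (simp add: shift_normal)
  next
    case 3
    then show ?thesis using that[of c a b] by (simp add: tact_gmul shift_normal)
  next
    case 4
    let ?x = "z * k ^ 2" and ?y = "z ^ 2 * k ^ 2"
    have "?x ^ 3 = (z ^ 3) * (k ^ 3) ^ 2" "?y ^ 3 = (z ^ 3) ^ 2 * (k ^ 3) ^ 2"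
      "?x * ?x * ?y = z * z ^ 3 * (k ^ 3) ^ 2" "?x * ?y = k * z ^ 3 * k ^ 3"
      by (simp_all add: power2_eq_square power3_eq_cube)
    then have "?x ^ 3 = 1" "?y ^ 3 = 1" "?x * ?x * ?y = z" "?x * ?y = k"
      using 4(2,3) by simp_all
    then show ?thesis
      using that hesse_normal_inverse[of ?x ?y a b c] 4(1) by metis
  qed
qed

lemma form_line:
  "form l (a + s * a') (b + s * b') (c + s * c') = poly [:form l a b c, form l a' b' c':] s"
  by (simp add: form_def algebra_simps)

lemma normal_line:
  "normal_array (a + s * a') (b + s * b') (c + s * c')
    = normal_array a b c + scale_array s (normal_array a' b' c')"
  by (rule array_ext3) simp_all

section \<open>Invariants that restrict to the discriminant\<close>

text \<open>What is needed of the form of degree \<open>36\<close>: its restriction to the normal arrays is, up to a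
  constant, the discriminant of the reflection group, in which every mirror occurs three times because
  the reflections have order three.\<close>

locale discriminant_like =
  fixes F :: "array \<Rightarrow> complex"
  assumes F_polyfun: "F \<in> polyfuns entries"
    and F_scale: "F (scale_array t x) = t ^ 36 * F x"
    and F_SL: "\<lbrakk>det A = 1; det B = 1; det C = 1\<rbrakk> \<Longrightarrow> F (act A B C x) = F x"
    and F_normal: "F (normal_array a b c) = - 4 * (\<Prod>l\<in>forms. form l a b c) ^ 3"
begin

text \<open>Each matrix is a scalar times a matrix of determinant one, where the scalar is a cube root of the
  determinant; homogeneity of degree \<open>36\<close> turns the scalars into the twelfth power.\<close>

lemma F_GL:
  assumes "g \<in> GL" shows "F (tact g x) = gdet g ^ 12 * F x"
proof -
  obtain A B C where g: "g = (A, B, C)" by (cases g)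
  have det: "det A \<noteq> 0" "det B \<noteq> 0" "det C \<noteq> 0"
    using assms by (auto simp: GL_def gdet_def g)
  obtain r A' where A: "det A' = 1" "r ^ 3 = det A" "A = (\<chi> i j. r * A' $ i $ j)"
    using det_cube_root[OF det(1)] .
  obtain s B' where B: "det B' = 1" "s ^ 3 = det B" "B = (\<chi> i j. s * B' $ i $ j)"
    using det_cube_root[OF det(2)] .
  obtain t C' where C: "det C' = 1" "t ^ 3 = det C" "C = (\<chi> i j. t * C' $ i $ j)"
    using det_cube_root[OF det(3)] .
  have "tact g x = scale_array (r * s * t) (act A' B' C' x)"
    unfolding g tact_simp by (subst A(3), subst B(3), subst C(3)) (rule act_scale_matrices)
  then have "F (tact g x) = (r * s * t) ^ 36 * F x"
    using A(1) B(1) C(1) by (simp add: F_scale F_SL)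
  also have "(r * s * t) ^ 36 = ((r ^ 3) * (s ^ 3) * (t ^ 3)) ^ 12"
    by (simp add: power_mult_distrib flip: power_mult)
  finally show ?thesis by (simp add: A B C gdet_def g)
qed

lemma F_GL_zero: "g \<in> GL \<Longrightarrow> F (tact g x) = 0 \<longleftrightarrow> F x = 0"
  by (auto simp: F_GL GL_def)

lemma F_normal_nonzero: "F (normal_array a b c) \<noteq> 0 \<longleftrightarrow> (\<forall>l\<in>forms. form l a b c \<noteq> 0)"
  using finite_forms by (simp add: F_normal)

lemma F_normal_value: "F (normal_array a b c) =
    - 4 * (a * b * c * ((a ^ 3 + b ^ 3 + c ^ 3) ^ 3 - 27 * (a * b * c) ^ 3)) ^ 3"
  by (simp add: F_normal prod_forms_value)

lemma F_normal_base: "F (normal_array 1 2 3) \<noteq> 0"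
  by (simp add: F_normal_value)

end

section \<open>Forms of degree at most 36 on the dual variety\<close>

text \<open>A polynomial function of degree at most \<open>36\<close> that vanishes wherever the hyperplane is tangent to
  the Segre variety. Its invariance is a consequence: it turns out to be a multiple of \<open>F\<close>.\<close>

locale tangent_form = discriminant_like +
  fixes p :: "array \<Rightarrow> complex"
  assumes p_polyfun: "p \<in> polyfuns entries"
    and p_degree: "\<And>x y. \<exists>P. degree P \<le> 36 \<and> (\<forall>s. p (x + scale_array s y) = poly P s)"
    and p_degenerate: "degenerate x \<Longrightarrow> p x = 0"
begin

lemma p_diag_split:
  assumes "g \<in> GL"
  obtains q where "q \<in> polyfuns coords"
    "\<And>v. p (tact g (diag_array (v 0) (v 1) (v 2) (v 3) (v 4))) = v 0 * v 1 * v 2 * q v"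
proof -
  have "(\<lambda>v. diag_array (v 0) (v 1) (v 2) (v 3) (v 4) $ i $ j $ k) \<in> polyfuns coords" for i j k
    by (simp add: diag_array_def) (intro polyfuns_intros coords_polyfun)
  then have pf: "(\<lambda>v. p (tact g (diag_array (v 0) (v 1) (v 2) (v 3) (v 4)))) \<in> polyfuns coords"
    by (intro polyfun_array_compose[OF p_polyfun] tact_polyfun)
  show ?thesis
  proof (rule polyfun_vanish_split3[OF pf])
    show "p (tact g (diag_array (x 0) (x 1) (x 2) (x 3) (x 4))) = 0"
      if "x 0 = 0 \<or> x 1 = 0 \<or> x 2 = 0" for x
      using that by (intro p_degenerate degenerate_tact assms degenerate_diag)
  qed (rule that)
qed

text \<open>Moving the mirror to \<open>a = 0\<close> makes \<open>p\<close> divisible by the product of the three diagonal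
  coefficients. These coincide on normal arrays, so the linear form divides \<open>p\<close> three times.\<close>

lemma form_cube_dvd:
  assumes g: "g \<in> GL" and l: "l \<in> forms"
    and P: "\<And>s. p (tact g (normal_array (a + s * a') (b + s * b') (c + s * c'))) = poly P s"
  shows "[:form l a b c, form l a' b' c':] ^ 3 dvd P"
proof -
  obtain w k m n where w: "w \<in> GL" "\<And>a b c. normal_array a b c
      = tact w (normal_array (k * form l a b c) (form m a b c) (form n a b c))"
    using form_frame[OF l] by blast
  obtain q where q: "q \<in> polyfuns coords" "\<And>v. p (tact (gmul g w)
      (diag_array (v 0) (v 1) (v 2) (v 3) (v 4))) = v 0 * v 1 * v 2 * q v"
    using p_diag_split[OF GL_gmul[OF g w(1)]] by blast
  define L where "L = [:form l a b c, form l a' b' c':]"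
  define v :: "complex \<Rightarrow> nat \<Rightarrow> complex" where
    "v s i = (if i \<le> 2 then k * poly L s
      else if i = 3 then poly [:form m a b c, form m a' b' c':] s
      else poly [:form n a b c, form n a' b' c':] s)" for s i
  have "(\<lambda>s. v s i) \<in> univariate" for i
    unfolding v_def L_def by (cases "i \<le> 2"; cases "i = 3")
      (auto intro!: polyfuns_intros univariate_ident)
  then have "(\<lambda>s. q (v s)) \<in> univariate"
    by (intro polyfuns_compose[OF q(1)]) auto
  then obtain Q where Q: "\<And>s. q (v s) = poly Q s"
    using univariate_poly by metis
  have "poly P s = poly (L ^ 3 * smult (k ^ 3) Q) s" for s
  proof -
    have "poly P s = p (tact g (tact w (normal_array
        (k * form l (a + s * a') (b + s * b') (c + s * c'))
        (form m (a + s * a') (b + s * b') (c + s * c'))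
        (form n (a + s * a') (b + s * b') (c + s * c')))))"
      by (simp only: P[symmetric] w(2)[symmetric])
    also have "\<dots> = p (tact (gmul g w) (diag_array (v s 0) (v s 1) (v s 2) (v s 3) (v s 4)))"
      by (simp add: form_line v_def L_def tact_gmul normal_array_diag)
    also have "\<dots> = v s 0 * v s 1 * v s 2 * poly Q s"
      by (simp only: q(2) Q)
    finally show ?thesis
      by (simp add: v_def power3_eq_cube)
  qed
  then have "P = L ^ 3 * smult (k ^ 3) Q"
    by (metis poly_eq_poly_eq_iff ext)
  then show ?thesis unfolding L_def by (metis dvd_triv_left)
qed

text \<open>On a line that meets the twelve mirrors in twelve different points, the cubes of the twelve linear
  forms are coprime divisors of \<open>p\<close>. Their product has degree \<open>36\<close>, which leaves only a constant
  factor.\<close>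

lemma proportional_on_line:
  assumes g: "g \<in> GL"
    and dir: "\<And>l. l \<in> forms \<Longrightarrow> form l a' b' c' \<noteq> 0"
    and roots: "\<And>l m. \<lbrakk>l \<in> forms; m \<in> forms; l \<noteq> m\<rbrakk>
      \<Longrightarrow> form l a b c * form m a' b' c' \<noteq> form m a b c * form l a' b' c'"
  obtains r where "\<And>s. p (tact g (normal_array (a + s * a') (b + s * b') (c + s * c')))
    = r * F (normal_array (a + s * a') (b + s * b') (c + s * c'))"
proof -
  define L where "L l = [:form l a b c, form l a' b' c':]" for l
  obtain P where P: "degree P \<le> 36"
    "\<And>s. p (tact g (normal_array (a + s * a') (b + s * b') (c + s * c'))) = poly P s"
    using p_degree[of "tact g (normal_array a b c)" "tact g (normal_array a' b' c')"]
    by (auto simp: normal_line tact_add tact_scale)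
  have dvd: "L l ^ 3 dvd P" if "l \<in> forms" for l
    unfolding L_def by (rule form_cube_dvd[OF g that P(2)])
  have cop: "coprime (L l) (L m)" if "l \<in> forms" "m \<in> forms" "l \<noteq> m" for l m
  proof (rule coprimeI)
    fix d assume "d dvd L l" "d dvd L m"
    then have "d dvd smult (form m a' b' c') (L l) - smult (form l a' b' c') (L m)"
      by (intro dvd_diff dvd_smult)
    also have "\<dots> = [:form l a b c * form m a' b' c' - form m a b c * form l a' b' c':]"
      by (simp add: L_def mult.commute)
    finally show "is_unit d"
      using roots[OF that] by (auto intro: dvd_trans[of d _ 1] simp: is_unit_pCons_iff)
  qed
  have prod_dvd: "(\<Prod>l\<in>A. L l ^ 3) dvd P" if "A \<subseteq> forms" for A
    using finite_subset[OF that finite_forms] that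
  proof (induction A rule: finite_induct)
    case (insert l A)
    have "coprime (L l ^ 3) (\<Prod>m\<in>A. L m ^ 3)"
      using insert by (intro prod_coprime_right) (auto intro!: cop)
    then show ?case using insert dvd by (simp add: divides_mult)
  qed simp
  obtain R where R: "P = (\<Prod>l\<in>forms. L l ^ 3) * R"
    using prod_dvd[OF subset_refl] by (elim dvdE)
  have L0: "L l \<noteq> 0" "degree (L l) = 1" if "l \<in> forms" for l
    using dir[OF that] by (simp_all add: L_def)
  have "degree (\<Prod>l\<in>forms. L l ^ 3) = (\<Sum>l\<in>forms. 3)"
    using L0 by (subst degree_prod_eq_sum_degree) (auto simp: degree_power_eq)
  then have deg: "degree (\<Prod>l\<in>forms. L l ^ 3) = 36" by (simp add: card_forms)
  have "degree R = 0"
  proof (cases "R = 0")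
    case False
    have "(\<Prod>l\<in>forms. L l ^ 3) \<noteq> 0" using L0 finite_forms by auto
    then have "degree P = 36 + degree R"
      using False deg by (simp add: R degree_mult_eq)
    then show ?thesis using P(1) by simp
  qed simp
  then obtain r where r: "R = [:r:]" by (rule degree_eq_zeroE)
  show ?thesis
  proof (rule that[of "- r / 4"])
    fix s
    have "poly P s = (\<Prod>l\<in>forms. poly (L l) s) ^ 3 * r"
      by (simp add: R r poly_prod prod_power_distrib)
    also have "(\<Prod>l\<in>forms. poly (L l) s) = (\<Prod>l\<in>forms. form l (a + s * a') (b + s * b') (c + s * c'))"
      by (simp only: L_def form_line)
    finally show "p (tact g (normal_array (a + s * a') (b + s * b') (c + s * c')))
        = - r / 4 * F (normal_array (a + s * a') (b + s * b') (c + s * c'))"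
      by (simp add: P(2) F_normal)
  qed
qed

end

text \<open>The points \<open>(t, t\<^sup>2, t\<^sup>3)\<close> span the space, so each of the conditions is the nonvanishing of
  a nonzero polynomial in \<open>t\<close>.\<close>

lemma generic_curve_point:
  assumes "\<And>l. l \<in> forms \<Longrightarrow> form l a b c \<noteq> 0"
  obtains B where "finite B"
    "\<And>t l. \<lbrakk>t \<notin> B; l \<in> forms\<rbrakk> \<Longrightarrow> form l t (t ^ 2) (t ^ 3) \<noteq> 0"
    "\<And>t l. \<lbrakk>t \<notin> B; l \<in> forms\<rbrakk> \<Longrightarrow> form l t (t ^ 2) (t ^ 3) \<noteq> form l a b c"
    "\<And>t l m. \<lbrakk>t \<notin> B; l \<in> forms; m \<in> forms; l \<noteq> m\<rbrakk> \<Longrightarrow>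
      form l a b c * form m t (t ^ 2) (t ^ 3) \<noteq> form m a b c * form l t (t ^ 2) (t ^ 3)"
proof -
  define h where "h l = [:0, fst l, fst (snd l), snd (snd l):]" for l :: "complex \<times> complex \<times> complex"
  have h: "poly (h l) t = form l t (t ^ 2) (t ^ 3)" for l t
    by (simp add: h_def form_def power2_eq_square power3_eq_cube algebra_simps)
  have h0: "h l \<noteq> 0" if "l \<in> forms" for l
    using that by (auto simp: h_def forms_def)
  have h1: "h l - [:form l a b c:] \<noteq> 0" if "l \<in> forms" for l
    using assms[OF that] by (simp add: h_def)
  have h2: "smult (form l a b c) (h m) - smult (form m a b c) (h l) \<noteq> 0"
    if "l \<in> forms" "m \<in> forms" "l \<noteq> m" for l m
  proof
    let ?x = "form l a b c" and ?y = "form m a b c"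
    assume "smult ?x (h m) - smult ?y (h l) = 0"
    then have eq: "?x * fst m = ?y * fst l" "?x * fst (snd m) = ?y * fst (snd l)"
      "?x * snd (snd m) = ?y * snd (snd l)"
      by (simp_all add: h_def)
    have "?x \<noteq> 0" "?y \<noteq> 0" using assms that by auto
    then have "fst m = ?y / ?x * fst l \<and> fst (snd m) = ?y / ?x * fst (snd l)
        \<and> snd (snd m) = ?y / ?x * snd (snd l)"
      using eq by (simp add: field_simps)
    then obtain k where "fst m = k * fst l" "fst (snd m) = k * fst (snd l)"
      "snd (snd m) = k * snd (snd l)"
      by blast
    then show False using forms_independent[OF that] by (simp add: mult_ac)
  qed
  define B where "B = (\<Union>l\<in>forms. {t. poly (h l) t = 0}) \<union> (\<Union>l\<in>forms. {t. poly (h l - [:form l a b c:]) t = 0})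
    \<union> (\<Union>l\<in>forms. \<Union>m\<in>forms - {l}.
      {t. poly (smult (form l a b c) (h m) - smult (form m a b c) (h l)) t = 0})"
  have "finite B"
    unfolding B_def
    by (intro finite_UnI finite_UN_I finite_forms finite_Diff poly_roots_finite h0 h1 h2) auto
  then show ?thesis
  proof (rule that)
    show "form l t (t ^ 2) (t ^ 3) \<noteq> 0" "form l t (t ^ 2) (t ^ 3) \<noteq> form l a b c"
      if "t \<notin> B" "l \<in> forms" for t l
      using that by (auto simp: B_def h)
    show "form l a b c * form m t (t ^ 2) (t ^ 3) \<noteq> form m a b c * form l t (t ^ 2) (t ^ 3)"
      if "t \<notin> B" "l \<in> forms" "m \<in> forms" "l \<noteq> m" for t l m
      using that by (auto simp: B_def h)
  qed
qed

context tangent_form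
begin

lemma proportional_to_curve:
  assumes g: "g \<in> GL"
    and ne: "\<And>l. l \<in> forms \<Longrightarrow> form l t (t ^ 2) (t ^ 3) \<noteq> form l a b c"
    and ind: "\<And>l m. \<lbrakk>l \<in> forms; m \<in> forms; l \<noteq> m\<rbrakk> \<Longrightarrow>
      form l a b c * form m t (t ^ 2) (t ^ 3) \<noteq> form m a b c * form l t (t ^ 2) (t ^ 3)"
  shows "p (tact g (normal_array a b c)) * F (normal_array t (t ^ 2) (t ^ 3))
    = p (tact g (normal_array t (t ^ 2) (t ^ 3))) * F (normal_array a b c)"
proof -
  have d: "form l (t - a) (t ^ 2 - b) (t ^ 3 - c) = form l t (t ^ 2) (t ^ 3) - form l a b c" for l
    by (simp add: form_def algebra_simps)
  obtain r where r: "\<And>s. p (tact g (normal_array (a + s * (t - a)) (b + s * (t ^ 2 - b)) (c + s * (t ^ 3 - c))))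
    = r * F (normal_array (a + s * (t - a)) (b + s * (t ^ 2 - b)) (c + s * (t ^ 3 - c)))"
  proof (rule proportional_on_line[OF g, of "t - a" "t ^ 2 - b" "t ^ 3 - c" a b c])
    show "form l (t - a) (t ^ 2 - b) (t ^ 3 - c) \<noteq> 0" if "l \<in> forms" for l
      using ne[OF that] by (simp add: d)
    show "form l a b c * form m (t - a) (t ^ 2 - b) (t ^ 3 - c)
        \<noteq> form m a b c * form l (t - a) (t ^ 2 - b) (t ^ 3 - c)"
      if "l \<in> forms" "m \<in> forms" "l \<noteq> m" for l m
      using ind[OF that] by (simp add: d algebra_simps)
  qed blast
  show ?thesis using r[of 0] r[of 1] by simp
qed

text \<open>The line through two given points may meet several mirrors in one point. Both points are therefore
  joined to a generic point of the curve.\<close>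

lemma proportional_on_normal:
  assumes g: "g \<in> GL" and F: "F (normal_array a b c) \<noteq> 0" "F (normal_array a' b' c') \<noteq> 0"
  shows "p (tact g (normal_array a b c)) * F (normal_array a' b' c')
    = p (tact g (normal_array a' b' c')) * F (normal_array a b c)"
proof -
  obtain B where B: "finite B"
    "\<And>t l. \<lbrakk>t \<notin> B; l \<in> forms\<rbrakk> \<Longrightarrow> form l t (t ^ 2) (t ^ 3) \<noteq> 0"
    "\<And>t l. \<lbrakk>t \<notin> B; l \<in> forms\<rbrakk> \<Longrightarrow> form l t (t ^ 2) (t ^ 3) \<noteq> form l a b c"
    "\<And>t l m. \<lbrakk>t \<notin> B; l \<in> forms; m \<in> forms; l \<noteq> m\<rbrakk> \<Longrightarrow>
      form l a b c * form m t (t ^ 2) (t ^ 3) \<noteq> form m a b c * form l t (t ^ 2) (t ^ 3)"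
    using generic_curve_point[of a b c] F(1) unfolding F_normal_nonzero by metis
  obtain B' where B': "finite B'"
    "\<And>t l. \<lbrakk>t \<notin> B'; l \<in> forms\<rbrakk> \<Longrightarrow> form l t (t ^ 2) (t ^ 3) \<noteq> form l a' b' c'"
    "\<And>t l m. \<lbrakk>t \<notin> B'; l \<in> forms; m \<in> forms; l \<noteq> m\<rbrakk> \<Longrightarrow>
      form l a' b' c' * form m t (t ^ 2) (t ^ 3) \<noteq> form m a' b' c' * form l t (t ^ 2) (t ^ 3)"
    using generic_curve_point[of a' b' c'] F(2) unfolding F_normal_nonzero by metis
  obtain t where t: "t \<notin> B" "t \<notin> B'"
    using ex_new_if_finite[OF infinite_UNIV_char_0, of "B \<union> B'"] B(1) B'(1) by auto
  let ?u = "normal_array a b c" and ?u' = "normal_array a' b' c'"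
    and ?v = "normal_array t (t ^ 2) (t ^ 3)"
  have v: "F ?v \<noteq> 0" using B(2)[OF t(1)] unfolding F_normal_nonzero by blast
  have 1: "p (tact g ?u) * F ?v = p (tact g ?v) * F ?u"
    using B(3,4) t(1) by (intro proportional_to_curve[OF g]) auto
  have 2: "p (tact g ?u') * F ?v = p (tact g ?v) * F ?u'"
    using B'(2,3) t(2) by (intro proportional_to_curve[OF g]) auto
  have "(p (tact g ?u) * F ?u') * F ?v = (p (tact g ?u') * F ?u) * F ?v"
    using 1 2 by algebra
  then show ?thesis using v by simp
qed

end

section \<open>The ratio of the two forms along an orbit\<close>

context tangent_form
begin

text \<open>The base point \<open>(1, 2, 3)\<close> lies on none of the mirrors.\<close>

definition ratio :: "mat3 \<times> mat3 \<times> mat3 \<Rightarrow> complex"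
  where "ratio g = p (tact g (normal_array 1 2 3)) / F (tact g (normal_array 1 2 3))"

lemma ratio_normal:
  assumes "g \<in> GL" "F (normal_array a b c) \<noteq> 0"
  shows "p (tact g (normal_array a b c)) = ratio g * F (tact g (normal_array a b c))"
proof -
  have "gdet g \<noteq> 0" using assms(1) by (simp add: GL_def)
  then show ?thesis
    using proportional_on_normal[OF assms F_normal_base] F_normal_base
    by (simp add: ratio_def F_GL[OF assms(1)] field_simps)
qed

lemma ratio_eqI:
  assumes "g \<in> GL" "h \<in> GL" "tact h (normal_array 1 2 3) = tact g (normal_array a b c)"
  shows "ratio h = ratio g"
proof -
  have "F (tact g (normal_array a b c)) \<noteq> 0"
    using F_GL_zero[OF assms(2)] F_normal_base assms(3) by metis
  then have "p (tact h (normal_array 1 2 3)) = ratio g * F (tact h (normal_array 1 2 3))"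
    using ratio_normal[OF assms(1)] F_GL_zero[OF assms(1)] assms(3) by metis
  then show ?thesis
    using F_GL_zero[OF assms(2)] F_normal_base by (simp add: ratio_def)
qed

lemma ratio_frame:
  assumes g: "g \<in> GL" and w: "w \<in> frames"
  shows "ratio (gmul g w) = ratio g"
proof -
  obtain a b c where eq: "normal_array 1 2 3 = tact w (normal_array a b c)"
    using frames_normal[OF w] .
  have gw: "gmul g w \<in> GL" by (rule GL_gmul[OF g frames_GL[OF w]])
  have "tact g (normal_array 1 2 3) = tact (gmul g w) (normal_array a b c)"
    by (simp add: tact_gmul eq)
  from ratio_eqI[OF gw g this] show ?thesis by simp
qed

text \<open>On the line \<open>(a, 1, 1)\<close> at \<open>a = 0\<close>, \<open>F\<close> vanishes exactly and \<open>p\<close> at least to third order,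
  and the ratio can be read off from the coefficients of \<open>a\<^sup>3\<close>. That of \<open>p\<close> is a value of \<open>q\<close> at the point
  \<open>x = y = z = 0\<close> of the slice, which the torus fixes: so the ratio does not depend on the
  torus element.\<close>

lemma ratio_torus_limit:
  assumes g: "g \<in> GL"
    and q: "q \<in> polyfuns coords"
      "\<And>v. p (tact g (diag_array (v 0) (v 1) (v 2) (v 3) (v 4))) = v 0 * v 1 * v 2 * q v"
    and t: "\<alpha> * \<beta> * \<gamma> = 1"
  shows "q (\<lambda>i. if i \<le> 2 then 0 else 1) = - 2048 * gdet g ^ 12 * ratio (gmul g (torus \<alpha> \<beta> \<gamma>))"
proof -
  have T: "torus \<alpha> \<beta> \<gamma> \<in> GL" and gT: "gmul g (torus \<alpha> \<beta> \<gamma>) \<in> GL"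
    using t GL_gmul[OF g] by (simp_all add: GL_def gdet_torus)
  define R where "R = gdet g ^ 12 * ratio (gmul g (torus \<alpha> \<beta> \<gamma>))"
  define v :: "complex \<Rightarrow> nat \<Rightarrow> complex" where
    "v a i = (if i = 0 then \<alpha> ^ 3 * a else if i = 1 then \<beta> ^ 3 * a else if i = 2 then \<gamma> ^ 3 * a else 1)" for a i
  \<comment> \<open>\<open>K 0 = 8\<close>, and \<open>2048 = 4 \<cdot> 8\<^sup>3\<close>.\<close>
  define K :: "complex \<Rightarrow> complex" where "K a = (a ^ 3 + 2) ^ 3 - 27 * a ^ 3" for a
  have Fa: "F (normal_array a 1 1) = - 4 * (a * K a) ^ 3" for a
    by (simp add: F_normal_value K_def add.commute)
  define e where "e a = q (v a) + 4 * R * K a ^ 3" for a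
  have vu: "(\<lambda>a. v a i) \<in> univariate" for i
    unfolding v_def by (cases "i = 0"; cases "i = 1"; cases "i = 2")
      (auto intro!: polyfuns_intros univariate_ident)
  have e_uni: "e \<in> univariate"
    unfolding e_def K_def by (intro polyfuns_intros polyfuns_compose[OF q(1)] polyfuns_power polyfuns_diff univariate_ident)
      (use vu in auto)
  have f_uni: "(\<lambda>a. F (normal_array a 1 1)) \<in> univariate"
    unfolding F_normal_value by (intro polyfuns_intros polyfuns_power polyfuns_diff univariate_ident)
  have fin: "finite {a. F (normal_array a 1 1) = 0}"
    by (rule univariate_finite_zeros[OF f_uni, of 2]) (simp add: F_normal_value)
  have "e 0 = 0"
  proof (rule univariate_zero[OF e_uni fin])
    fix a assume "a \<notin> {a. F (normal_array a 1 1) = 0}"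
    then have F0: "F (normal_array a 1 1) \<noteq> 0" by simp
    then have a: "a \<noteq> 0" by (auto simp: Fa)
    have tor: "tact (gmul g (torus \<alpha> \<beta> \<gamma>)) (normal_array a 1 1)
        = tact g (diag_array (v a 0) (v a 1) (v a 2) (v a 3) (v a 4))"
      by (simp add: tact_gmul torus_normal[OF t] v_def)
    have "(\<alpha> * \<beta> * \<gamma>) ^ 3 * a ^ 3 * q (v a)
        = p (tact (gmul g (torus \<alpha> \<beta> \<gamma>)) (normal_array a 1 1))"
      unfolding tor q(2) by (simp add: v_def power_mult_distrib power3_eq_cube)
    also have "\<dots> = ratio (gmul g (torus \<alpha> \<beta> \<gamma>)) * F (tact (gmul g (torus \<alpha> \<beta> \<gamma>)) (normal_array a 1 1))"
      by (rule ratio_normal[OF gT F0])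
    also have "\<dots> = R * F (normal_array a 1 1)"
      by (simp add: F_GL[OF gT] gdet_gmul gdet_torus t R_def)
    finally have "a ^ 3 * q (v a) = R * F (normal_array a 1 1)" by (simp add: t)
    then have "a ^ 3 * e a = 0"
      by (simp add: e_def Fa power_mult_distrib algebra_simps)
    then show "e a = 0" using a by simp
  qed
  moreover have "v 0 = (\<lambda>i. if i \<le> 2 then 0 else 1)"
    by (auto simp: v_def fun_eq_iff)
  ultimately show ?thesis
    by (simp add: e_def K_def R_def eq_neg_iff_add_eq_0 mult.assoc)
qed

lemma ratio_torus:
  assumes g: "g \<in> GL" and t: "\<alpha> * \<beta> * \<gamma> = 1"
  shows "ratio (gmul g (torus \<alpha> \<beta> \<gamma>)) = ratio g"
proof -
  obtain q where q: "q \<in> polyfuns coords"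
      "\<And>v. p (tact g (diag_array (v 0) (v 1) (v 2) (v 3) (v 4))) = v 0 * v 1 * v 2 * q v"
    using p_diag_split[OF g] by blast
  have "gdet g \<noteq> 0" using g by (simp add: GL_def)
  then have "ratio (gmul g (torus \<alpha> \<beta> \<gamma>)) = ratio (gmul g (torus 1 1 1))"
    using ratio_torus_limit[OF g q t] ratio_torus_limit[OF g q, of 1 1 1] by simp
  also have "tact (torus 1 1 1) (normal_array 1 2 3) = normal_array 1 2 3"
    by (subst torus_normal) (simp_all add: normal_array_diag)
  then have "ratio (gmul g (torus 1 1 1)) = ratio g"
    by (simp add: ratio_def tact_gmul)
  finally show ?thesis .
qed

text \<open>If the diagonal coefficients are nonzero, the torus makes them equal to a cube root of their
  product.\<close>

lemma ratio_diag:
  assumes fh: "\<And>g a b c. \<lbrakk>g \<in> GL; F (normal_array a b c) \<noteq> 0\<rbrakk> \<Longrightarrow>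
      f (tact g (normal_array a b c)) = ratio g * h (tact g (normal_array a b c))"
    and g: "g \<in> GL" and nz: "x \<noteq> 0" "y \<noteq> 0" "z \<noteq> 0" and F: "F (diag_array x y z b c) \<noteq> 0"
  shows "f (tact g (diag_array x y z b c)) = ratio g * h (tact g (diag_array x y z b c))"
proof -
  obtain a where a: "x * y * z = a ^ 3" using exists_complex_root[of 3 "x * y * z"] by auto
  have "a \<noteq> 0" using a nz by auto
  obtain \<alpha> where \<alpha>: "\<alpha> \<noteq> 0" "x / a = \<alpha> ^ 3"
    using exists_complex_root_nonzero[of "x / a" 3] nz \<open>a \<noteq> 0\<close> by auto
  obtain \<beta> where \<beta>: "\<beta> \<noteq> 0" "y / a = \<beta> ^ 3"
    using exists_complex_root_nonzero[of "y / a" 3] nz \<open>a \<noteq> 0\<close> by auto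
  define \<gamma> where "\<gamma> = 1 / (\<alpha> * \<beta>)"
  have t: "\<alpha> * \<beta> * \<gamma> = 1" using \<alpha> \<beta> by (simp add: \<gamma>_def)
  have xy: "x = \<alpha> ^ 3 * a" "y = \<beta> ^ 3 * a" using \<alpha> \<beta> \<open>a \<noteq> 0\<close> by (simp_all add: field_simps)
  have "(\<alpha> ^ 3 * \<beta> ^ 3 * z) * a ^ 2 = a * a ^ 2"
    using a by (simp add: xy power2_eq_square power3_eq_cube mult_ac)
  then have "\<alpha> ^ 3 * \<beta> ^ 3 * z = a"
    using \<open>a \<noteq> 0\<close> by (metis mult_right_cancel power_not_zero)
  then have z: "z = \<gamma> ^ 3 * a"
    using \<alpha> \<beta> by (simp add: \<gamma>_def field_simps)
  have diag: "diag_array x y z b c = tact (torus \<alpha> \<beta> \<gamma>) (normal_array a b c)"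
    by (simp add: torus_normal[OF t] xy z)
  have T: "torus \<alpha> \<beta> \<gamma> \<in> GL" using t by (simp add: GL_def gdet_torus)
  have "F (normal_array a b c) \<noteq> 0" using F F_GL_zero[OF T] by (simp add: diag)
  from fh[OF GL_gmul[OF g T] this] show ?thesis
    by (simp add: diag tact_gmul ratio_torus[OF g t])
qed

text \<open>A normal array off the mirrors stays in the torus orbit of the normal arrays when a diagonal entry
  is changed slightly, and the ratio is constant along this change.\<close>

lemma ratio_dirderiv_diag:
  assumes f: "f \<in> polyfuns entries" and h: "h \<in> polyfuns entries"
    and fh: "\<And>g a b c. \<lbrakk>g \<in> GL; F (normal_array a b c) \<noteq> 0\<rbrakk> \<Longrightarrow>
      f (tact g (normal_array a b c)) = ratio g * h (tact g (normal_array a b c))"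
    and g: "g \<in> GL" and F: "F (normal_array a b c) \<noteq> 0"
  shows "dirderiv (tact g (unit_array i i i)) f (tact g (normal_array a b c))
    = ratio g * dirderiv (tact g (unit_array i i i)) h (tact g (normal_array a b c))"
proof (rule dirderiv_eqI[OF f h])
  let ?d = "\<lambda>s. normal_array a b c + scale_array s (unit_array i i i)"
  have a: "a \<noteq> 0" using F by (auto simp: F_normal_value)
  have 0: "?d 0 = normal_array a b c" by (rule array_eqI) simp
  obtain x y z where d: "\<And>s. ?d s = diag_array (x s) (y s) (z s) b c"
    and nz: "\<And>s. a + s \<noteq> 0 \<Longrightarrow> x s \<noteq> 0 \<and> y s \<noteq> 0 \<and> z s \<noteq> 0"
  proof -
    have "i = 1 \<or> i = 2 \<or> i = 3" by (rule exhaust_3)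
    then show ?thesis
    proof (elim disjE)
      assume i: "i = 1"
      show ?thesis by (rule that[of "\<lambda>s. a + s" "\<lambda>s. a" "\<lambda>s. a"])
        (use a in \<open>auto simp: i unit_array_nth intro!: array_ext3\<close>)
    next
      assume i: "i = 2"
      show ?thesis by (rule that[of "\<lambda>s. a" "\<lambda>s. a + s" "\<lambda>s. a"])
        (use a in \<open>auto simp: i unit_array_nth intro!: array_ext3\<close>)
    next
      assume i: "i = 3"
      show ?thesis by (rule that[of "\<lambda>s. a" "\<lambda>s. a" "\<lambda>s. a + s"])
        (use a in \<open>auto simp: i unit_array_nth intro!: array_ext3\<close>)
    qed
  qed
  have "eventually (\<lambda>s. F (?d s) \<noteq> 0) (nhds 0)"
    by (rule univariate_eventually_nonzero[OF polyfun_line[OF F_polyfun]]) (simp only: 0, rule F)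
  moreover have "(\<lambda>s. a + s) \<in> univariate"
    by (intro polyfuns_intros univariate_ident)
  then have "eventually (\<lambda>s. a + s \<noteq> 0) (nhds 0)"
    by (rule univariate_eventually_nonzero) (simp add: a)
  ultimately have "eventually (\<lambda>s. f (tact g (?d s)) = ratio g * h (tact g (?d s))) (nhds 0)"
  proof eventually_elim
    case (elim s)
    then show ?case
      unfolding d using nz[of s] by (intro ratio_diag[OF fh g]) auto
  qed
  then show "eventually (\<lambda>s. f (tact g (normal_array a b c) + scale_array s (tact g (unit_array i i i)))
      = ratio g * h (tact g (normal_array a b c) + scale_array s (tact g (unit_array i i i)))) (nhds 0)"
    by (simp add: tact_add tact_scale)
qed

text \<open>Every frame \<open>w\<close> permutes the normal arrays off the mirrors and has \<open>ratio (g w) = ratio g\<close>.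
  So the relation between the derivatives holds in the directions \<open>g w E\<^sub>i\<^sub>i\<^sub>i\<close>, and these
  span all arrays.\<close>

lemma ratio_dirderiv:
  assumes f: "f \<in> polyfuns entries" and h: "h \<in> polyfuns entries"
    and fh: "\<And>g a b c. \<lbrakk>g \<in> GL; F (normal_array a b c) \<noteq> 0\<rbrakk> \<Longrightarrow>
      f (tact g (normal_array a b c)) = ratio g * h (tact g (normal_array a b c))"
    and g: "g \<in> GL" and F: "F (normal_array a b c) \<noteq> 0"
  shows "dirderiv y f (tact g (normal_array a b c)) = ratio g * dirderiv y h (tact g (normal_array a b c))"
proof -
  let ?x = "tact g (normal_array a b c)"
  define L where "L y = dirderiv (tact g y) f ?x - ratio g * dirderiv (tact g y) h ?x" for y
  have L: "L (y + z) = L y + L z" "L (scale_array s y) = s * L y" for y z s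
    by (simp_all add: L_def tact_add tact_scale dirderiv_add dirderiv_scale f h algebra_simps)
  define m where "m = (\<chi> i j k. L (unit_array i j k))"
  have Lm: "L y = pairing m y" for y
    unfolding m_def by (rule linear_pairing) (rule L)+
  have "pairing m (tact w (unit_array i i i)) = 0" if w: "w \<in> frames" for w i
  proof -
    obtain a' b' c' where eq: "normal_array a b c = tact w (normal_array a' b' c')"
      using frames_normal[OF w] .
    have "F (normal_array a' b' c') \<noteq> 0"
      using F F_GL_zero[OF frames_GL[OF w]] unfolding eq by blast
    from ratio_dirderiv_diag[OF f h fh GL_gmul[OF g frames_GL[OF w]] this, of i]
    show ?thesis
      by (simp add: Lm[symmetric] L_def eq tact_gmul ratio_frame[OF g w])
  qed
  then have "m = 0" by (rule frames_span)
  then have L0: "L y = 0" for y by (simp add: Lm pairing_def)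
  obtain z where "tact g z = y" using g by (rule tact_surj)
  then show ?thesis using L0[of z] by (simp add: L_def)
qed

lemma tangent_form_proportional: "p x = ratio gone * F x"
proof -
  let ?I = "{(g, a, b, c). g \<in> GL \<and> F (normal_array a b c) \<noteq> 0}"
    and ?pt = "\<lambda>(g, a, b, c). tact g (normal_array a b c)" and ?c = "\<lambda>(g, a :: complex, b :: complex, c :: complex). ratio g"
  have "p (?pt (gone, 1, 2, 3) + (x - normal_array 1 2 3))
      = ?c (gone, 1, 2, 3) * F (?pt (gone, 1, 2, 3) + (x - normal_array 1 2 3))"
  proof (rule proportional_spread[where I = ?I and V = UNIV and pt = ?pt and c = ?c])
    fix f h i y
    assume f: "f \<in> polyfuns entries" and h: "h \<in> polyfuns entries"
      and fh: "\<And>i. i \<in> ?I \<Longrightarrow> f (?pt i) = ?c i * h (?pt i)" and i: "i \<in> ?I"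
    have fh': "f (tact g (normal_array a b c)) = ratio g * h (tact g (normal_array a b c))"
      if "g \<in> GL" "F (normal_array a b c) \<noteq> 0" for g a b c
      using fh[of "(g, a, b, c)"] that by simp
    obtain g a b c where "i = (g, a, b, c)" by (cases i)
    then show "dirderiv y f (?pt i) = ?c i * dirderiv y h (?pt i)"
      using i ratio_dirderiv[OF f h fh'] by simp
  next
    show "p (?pt i) = ?c i * F (?pt i)" if "i \<in> ?I" for i
      using that ratio_normal by auto
    show "(gone, 1, 2, 3) \<in> ?I" using F_normal_base by simp
  qed (use p_polyfun F_polyfun in simp_all)
  then show ?thesis by simp
qed

end


section \<open>The discriminant vanishes on the dual variety\<close>

text \<open>Once the point of tangency is \<open>e\<^sub>1 \<otimes> e\<^sub>1 \<otimes> e\<^sub>1\<close>, a degenerate array has nonzero entries only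
  where at most one index is \<open>1\<close>; the core positions are those with exactly one.\<close>

definition core :: "3 \<Rightarrow> 3 \<Rightarrow> 3 \<Rightarrow> bool"
  where "core i j k \<longleftrightarrow> (i = 1 \<and> j \<noteq> 1 \<and> k \<noteq> 1) \<or> (i \<noteq> 1 \<and> j = 1 \<and> k \<noteq> 1) \<or> (i \<noteq> 1 \<and> j \<noteq> 1 \<and> k = 1)"

definition core_arrays :: "array set"
  where "core_arrays = {x. \<forall>i j k. \<not> core i j k \<longrightarrow> x $ i $ j $ k = 0}"

text \<open>For \<open>p = q\<close> this is a diagonal matrix.\<close>

definition elementary :: "3 \<Rightarrow> 3 \<Rightarrow> complex \<Rightarrow> mat3"
  where "elementary p q s = (\<chi> i j. (if i = j then 1 else 0) + (if i = p \<and> j = q then s else 0))"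

lemma det_elementary: "det (elementary p q s) = (if p = q then 1 + s else 1)"
  using exhaust_3[of p] exhaust_3[of q]
  by (elim disjE) (simp_all add: det_3 elementary_def)

lemma elementary_sum:
  "(\<Sum>j\<in>UNIV. elementary p q s $ i $ j * f j) = f i + (if i = p then s * f q else 0)"
proof -
  have "elementary p q s $ i $ j * f j = (if j = i then f j else 0) + (if j = q then (if i = p then s else 0) * f j else 0)" for j
    by (auto simp: elementary_def distrib_right)
  then show ?thesis by (simp add: sum.distrib)
qed

text \<open>Adds \<open>s\<close> times the slice \<open>q\<close> to the slice \<open>p\<close> in one of the three directions.\<close>

definition slot :: "nat \<Rightarrow> 3 \<Rightarrow> 3 \<Rightarrow> complex \<Rightarrow> mat3 \<times> mat3 \<times> mat3"
  where "slot n p q s = (if n = 0 then (elementary p q s, mat 1, mat 1)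
    else if n = 1 then (mat 1, elementary p q s, mat 1) else (mat 1, mat 1, elementary p q s))"

definition slot_dir :: "nat \<Rightarrow> 3 \<Rightarrow> 3 \<Rightarrow> array \<Rightarrow> array"
  where "slot_dir n p q x = (\<chi> i j k.
    if n = 0 then (if i = p then x $ q $ j $ k else 0)
    else if n = 1 then (if j = p then x $ i $ q $ k else 0) else (if k = p then x $ i $ j $ q else 0))"

lemma gdet_slot: "gdet (slot n p q s) = (if p = q then 1 + s else 1)"
  by (simp add: slot_def gdet_def det_elementary)

lemma tact_slot: "tact (slot n p q s) x = x + scale_array s (slot_dir n p q x)"
  by (rule array_eqI)
    (simp add: slot_def slot_dir_def act_nth_nested elementary_sum mat1_sum)

text \<open>The equivalence makes the inverse images of core arrays core arrays.\<close>

definition core_stabilizer :: "(mat3 \<times> mat3 \<times> mat3) set"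
  where "core_stabilizer = {g \<in> GL. \<forall>y. tact g y \<in> core_arrays \<longleftrightarrow> y \<in> core_arrays}"

lemma core_stabilizer_gmul:
  "g \<in> core_stabilizer \<Longrightarrow> h \<in> core_stabilizer \<Longrightarrow> gmul g h \<in> core_stabilizer"
  by (simp add: core_stabilizer_def GL_gmul tact_gmul)

lemma slot_core_stabilizer:
  assumes "p = 1 \<longleftrightarrow> q = 1" "s \<noteq> -1"
  shows "slot n p q s \<in> core_stabilizer"
proof -
  have s: "1 + s \<noteq> 0" using assms(2) by (simp add: add_eq_0_iff)
  have core_q: "core p j k = core q j k" "core j p k = core j q k" "core j k p = core j k q" for j k
    using assms(1) by (simp_all add: core_def)
  have "tact (slot n p q s) y \<in> core_arrays \<longleftrightarrow> y \<in> core_arrays" for y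
  proof
    assume "y \<in> core_arrays"
    then show "tact (slot n p q s) y \<in> core_arrays"
      by (auto simp: core_arrays_def tact_slot slot_dir_def core_q)
  next
    assume y: "tact (slot n p q s) y \<in> core_arrays"
    let ?d = "slot_dir n p q y"
    have eq: "y $ i $ j $ k + s * ?d $ i $ j $ k = 0" if "\<not> core i j k" for i j k
      using y that by (simp add: core_arrays_def tact_slot)
    show "y \<in> core_arrays"
    proof (cases "p = q")
      case True
      have "y $ i $ j $ k = 0 \<or> (1 + s) * y $ i $ j $ k = 0" if "\<not> core i j k" for i j k
        using eq[OF that] True by (auto simp: slot_dir_def algebra_simps split: if_splits)
      then show ?thesis using s by (auto simp: core_arrays_def)
    next
      case False
      have "slot_dir n p q y $ i $ j $ k = 0" if "\<not> core i j k" for i j k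
      proof -
        have "y $ q $ j $ k = 0" if "n = 0" "i = p"
          using eq[of q j k] \<open>\<not> core i j k\<close> that False core_q by (simp add: slot_dir_def)
        moreover have "y $ i $ q $ k = 0" if "n = 1" "j = p"
          using eq[of i q k] \<open>\<not> core i j k\<close> that False core_q by (simp add: slot_dir_def)
        moreover have "y $ i $ j $ q = 0" if "n \<noteq> 0" "n \<noteq> 1" "k = p"
          using eq[of i j q] \<open>\<not> core i j k\<close> that False core_q by (simp add: slot_dir_def)
        ultimately show ?thesis by (auto simp: slot_dir_def)
      qed
      then show ?thesis using eq by (simp add: core_arrays_def)
    qed
  qed
  moreover have "slot n p q s \<in> GL" using s by (simp add: GL_def gdet_slot)
  ultimately show ?thesis by (simp add: core_stabilizer_def)
qed

text \<open>The directions \<open>slot_dir\<close> are tangent to the orbit of \<open>normal_array 0 a b\<close>. Together with \<open>X2\<close>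
  they span the twelve-dimensional space of core arrays: off the support of \<open>X2\<close> and \<open>X3\<close> they
  give two cyclic systems of determinant \<open>a\<^sup>3 + b\<^sup>3\<close>, and on it they identify the three entries
  of \<open>m\<close> belonging to each of \<open>X2\<close> and \<open>X3\<close>.\<close>

lemma pairing_core_zero:
  assumes ab: "a \<noteq> 0" "b \<noteq> 0" "a ^ 3 + b ^ 3 \<noteq> 0"
    and dir: "\<And>n p q. (p = 1 \<longleftrightarrow> q = 1) \<Longrightarrow> pairing m (slot_dir n p q (normal_array 0 a b)) = 0"
    and X2: "pairing m (normal_array 0 1 0) = 0"
    and y: "y \<in> core_arrays"
  shows "pairing m y = 0"
proof -
  note expand = pairing_def sum_3 slot_dir_def
  have circ: "u = 0 \<and> v = 0 \<and> w = 0" if "a * u + b * v = 0" "a * v + b * w = 0" "a * w + b * u = 0"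
    for u v w :: complex
  proof -
    have "(a ^ 3 + b ^ 3) * u = 0" "(a ^ 3 + b ^ 3) * v = 0" "(a ^ 3 + b ^ 3) * w = 0"
      using that by algebra+
    then show ?thesis using ab(3) by simp
  qed
  have "m$2$1$2 = 0 \<and> m$2$2$1 = 0 \<and> m$1$2$2 = 0"
    using dir[of 2 3 0] dir[of 2 3 1] dir[of 2 3 2]
    by (intro circ) (simp_all add: expand mult.commute add.commute)
  moreover have "m$3$3$1 = 0 \<and> m$3$1$3 = 0 \<and> m$1$3$3 = 0"
    using dir[of 3 2 0] dir[of 3 2 1] dir[of 3 2 2]
    by (intro circ) (simp_all add: expand mult.commute add.commute)
  moreover have "m$1$2$3 = 0 \<and> m$2$3$1 = 0 \<and> m$3$1$2 = 0 \<and> m$1$3$2 = 0 \<and> m$2$1$3 = 0 \<and> m$3$2$1 = 0"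
  proof -
    have "a * m$2$3$1 + b * m$2$1$3 = 0" "a * m$3$1$2 + b * m$3$2$1 = 0" "a * m$1$2$3 + b * m$1$3$2 = 0"
      "a * m$3$1$2 + b * m$2$1$3 = 0" "a * m$1$2$3 + b * m$3$2$1 = 0" "a * m$2$3$1 + b * m$1$3$2 = 0"
      using dir[of 2 2 0] dir[of 3 3 0] dir[of 1 1 0] dir[of 1 1 1] dir[of 2 2 1] dir[of 3 3 1]
      by (simp_all add: expand mult.commute add.commute)
    moreover have "m$1$2$3 + m$2$3$1 + m$3$1$2 = 0"
      using X2 by (simp add: expand)
    ultimately have "3 * a * m$1$2$3 = 0" "3 * a * m$2$3$1 = 0" "3 * a * m$3$1$2 = 0"
      "3 * b * m$1$3$2 = 0" "3 * b * m$2$1$3 = 0" "3 * b * m$3$2$1 = 0"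
      by algebra+
    then show ?thesis using ab by simp
  qed
  ultimately have m0: "m $ i $ j $ k = 0" if "core i j k" for i j k
    using that exhaust_3[of i] exhaust_3[of j] exhaust_3[of k] by (auto simp: core_def)
  have "m $ i $ j $ k * y $ i $ j $ k = 0" for i j k
    using m0 y by (cases "core i j k") (auto simp: core_arrays_def)
  then show ?thesis by (simp only: pairing_def sum.neutral_const)
qed

context discriminant_like
begin

text \<open>\<open>F\<close> vanishes on the orbits of the arrays \<open>normal_array 0 a b\<close>, which lie on a mirror. Their
  tangent directions span the core arrays, so \<open>F\<close> vanishes on all core arrays.\<close>

lemma F_core_zero:
  assumes "y \<in> core_arrays" shows "F y = 0"
proof -
  let ?I = "{(g, a, b). g \<in> core_stabilizer \<and> a \<noteq> 0 \<and> b \<noteq> 0 \<and> a ^ 3 + b ^ 3 \<noteq> 0}"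
    and ?pt = "\<lambda>(g, a, b). tact g (normal_array 0 a b)"
    and ?c = "\<lambda>_ :: (mat3 \<times> mat3 \<times> mat3) \<times> complex \<times> complex. 0 :: complex"
  have gone: "gone \<in> core_stabilizer" by (simp add: core_stabilizer_def)
  have base: "normal_array 0 1 1 \<in> core_arrays"
    unfolding core_arrays_def core_def
    by (simp add: forall_3)
  have "F (?pt (gone, 1, 1) + (y - normal_array 0 1 1))
      = ?c (gone, 1, 1) * F (?pt (gone, 1, 1) + (y - normal_array 0 1 1))"
  proof (rule proportional_spread[where I = ?I and V = core_arrays and pt = ?pt and c = ?c])
    fix f h :: "array \<Rightarrow> complex" and i :: "(mat3 \<times> mat3 \<times> mat3) \<times> complex \<times> complex" and y
    assume f: "f \<in> polyfuns entries" and fh: "\<And>i. i \<in> ?I \<Longrightarrow> f (?pt i) = ?c i * h (?pt i)"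
      and i: "i \<in> ?I" and y: "y \<in> core_arrays"
    obtain g a b where iab: "i = (g, a, b)" by (cases i)
    have g: "g \<in> core_stabilizer" and ab: "a \<noteq> 0" "b \<noteq> 0" "a ^ 3 + b ^ 3 \<noteq> 0"
      using i by (simp_all add: iab)
    have f0: "f (tact g (normal_array 0 a b)) = 0"
      if "g \<in> core_stabilizer" "a \<noteq> 0" "b \<noteq> 0" "a ^ 3 + b ^ 3 \<noteq> 0" for g a b
      using fh[of "(g, a, b)"] that by simp
    let ?x = "tact g (normal_array 0 a b)"
    define L where "L y = dirderiv (tact g y) f ?x" for y
    define m where "m = (\<chi> i j k. L (unit_array i j k))"
    have Lm: "L y = pairing m y" for y
      unfolding m_def by (rule linear_pairing)
        (simp_all add: L_def tact_add tact_scale dirderiv_add dirderiv_scale f)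
    have zeroI: "dirderiv z f ?x = 0"
      if "eventually (\<lambda>s. f (?x + scale_array s z) = 0) (nhds 0)" for z
      using dirderiv_eqI[OF f polyfuns.const, of ?x z 0 0] that by simp
    have dir: "pairing m (slot_dir n p q (normal_array 0 a b)) = 0" if pq: "p = 1 \<longleftrightarrow> q = 1" for n p q
    proof -
      have "f (?x + scale_array s (tact g (slot_dir n p q (normal_array 0 a b)))) = 0" if "s \<noteq> -1" for s
      proof -
        have "?x + scale_array s (tact g (slot_dir n p q (normal_array 0 a b)))
            = tact (gmul g (slot n p q s)) (normal_array 0 a b)"
          by (simp add: tact_gmul tact_slot tact_add tact_scale)
        then show ?thesis
          using f0[OF core_stabilizer_gmul[OF g slot_core_stabilizer[OF pq that]] ab] by simp
      qed
      moreover have "eventually (\<lambda>s :: complex. s \<noteq> -1) (nhds 0)"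
        by (rule t1_space_nhds) simp
      ultimately show ?thesis
        unfolding Lm[symmetric] L_def by (intro zeroI) (auto elim: eventually_mono)
    qed
    have X2: "pairing m (normal_array 0 1 0) = 0"
    proof -
      have line: "?x + scale_array s (tact g (normal_array 0 1 0)) = tact g (normal_array 0 (a + s) b)" for s
        using normal_line[of 0 s 0 a 1 b 0] by (simp add: tact_add tact_scale)
      have "(\<lambda>s. (a + s) * ((a + s) ^ 3 + b ^ 3)) \<in> univariate"
        by (intro polyfuns_intros polyfuns_power univariate_ident)
      then have "eventually (\<lambda>s. (a + s) * ((a + s) ^ 3 + b ^ 3) \<noteq> 0) (nhds 0)"
        by (rule univariate_eventually_nonzero) (use ab in simp)
      then have "eventually (\<lambda>s. f (?x + scale_array s (tact g (normal_array 0 1 0))) = 0) (nhds 0)"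
        by eventually_elim (use ab f0[OF g] in \<open>auto simp: line\<close>)
      then show ?thesis
        unfolding Lm[symmetric] L_def by (rule zeroI)
    qed
    have "g \<in> GL" using g by (simp add: core_stabilizer_def)
    then obtain z where z: "tact g z = y" by (rule tact_surj)
    then have "z \<in> core_arrays" using g y by (auto simp: core_stabilizer_def)
    from pairing_core_zero[OF ab dir X2 this] have "L z = 0" by (simp add: Lm)
    then show "dirderiv y f (?pt i) = ?c i * dirderiv y h (?pt i)"
      by (simp add: L_def z iab)
  next
    show "F (?pt i) = ?c i * F (?pt i)" if "i \<in> ?I" for i
      using that F_GL_zero by (auto simp: core_stabilizer_def F_normal_value)
    show "(gone, 1 :: complex, 1 :: complex) \<in> ?I" using gone by simp
    show "y - normal_array 0 1 1 \<in> core_arrays"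
      using assms base by (simp add: core_arrays_def)
  qed (rule F_polyfun)+
  then show ?thesis by simp
qed

text \<open>The torus element \<open>diag (s\<^sup>-\<^sup>2, s, s)\<close> fixes the core entries and multiplies the other
  remaining entries by \<open>s\<^sup>3\<close>. As \<open>F\<close> is constant along this orbit, its value is that at the
  limit \<open>s = 0\<close>, a core array.\<close>

lemma F_degenerate:
  assumes "degenerate x" shows "F x = 0"
proof -
  obtain g where g: "g \<in> GL" and W: "\<And>p. tact g x $ p $ 1 $ 1 = 0" "\<And>p. tact g x $ 1 $ p $ 1 = 0"
    "\<And>p. tact g x $ 1 $ 1 $ p = 0"
    using degenerate_normalize[OF assms] by metis
  define y where "y = tact g x"
  define y0 :: array where "y0 = (\<chi> i j k. if core i j k then y $ i $ j $ k else 0)"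
  have lim: "tact (torus (1 / s ^ 2) s s) y = y0 + scale_array (s ^ 3) (y - y0)" if "s \<noteq> 0" for s
    using that W unfolding y_def[symmetric]
    by (intro array_ext3) (simp_all add: torus_nth y0_def core_def power2_eq_square power3_eq_cube)
  have "(\<lambda>s. F (y0 + scale_array (s ^ 3) (y - y0)) - F y) \<in> univariate"
    by (intro polyfuns_diff polyfuns.const polyfun_array_compose[OF F_polyfun])
      (simp, intro polyfuns_intros polyfuns_power univariate_ident)
  then have "F (y0 + scale_array (0 ^ 3) (y - y0)) - F y = 0"
  proof (rule univariate_zero[of _ "{0}"])
    fix s :: complex assume "s \<notin> {0}"
    then have s: "s \<noteq> 0" by simp
    then have "gdet (torus (1 / s ^ 2) s s) = 1"
      by (simp add: gdet_torus power2_eq_square)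
    then show "F (y0 + scale_array (s ^ 3) (y - y0)) - F y = 0"
      using F_GL[of "torus (1 / s ^ 2) s s" y] by (simp add: lim[OF s] GL_def)
  qed simp
  moreover have "y0 + scale_array (0 ^ 3) (y - y0) = y0" by (rule array_eqI) simp
  moreover have "F y0 = 0" by (rule F_core_zero) (simp add: core_arrays_def y0_def)
  ultimately show ?thesis using F_GL_zero[OF g] by (simp add: y_def)
qed

end

section \<open>The hyperdeterminant\<close>

text \<open>Passing to the Zariski closure does not change which forms vanish.\<close>

lemma vanishes_on_dual_iff:
  assumes "homogeneous_poly d p"
  shows "(\<forall>x\<in>segre_dual. eval_poly p x = 0) \<longleftrightarrow> (\<forall>x\<in>tangent_hyperplanes. eval_poly p x = 0)"
proof
  assume dual: "\<forall>x\<in>segre_dual. eval_poly p x = 0"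
  show "\<forall>x\<in>tangent_hyperplanes. eval_poly p x = 0"
  proof
    fix x assume "x \<in> tangent_hyperplanes"
    then have "x \<in> segre_dual"
      unfolding segre_dual_def projective_zariski_closure_def by (auto simp: tangent_hyperplanes_iff)
    then show "eval_poly p x = 0" using dual by blast
  qed
next
  assume "\<forall>x\<in>tangent_hyperplanes. eval_poly p x = 0"
  then show "\<forall>x\<in>segre_dual. eval_poly p x = 0"
    using assms unfolding segre_dual_def projective_zariski_closure_def by blast
qed

text \<open>The zero array is degenerate but represents no hyperplane; it is reached along a line of nonzero
  degenerate arrays.\<close>

lemma vanishes_at_zero:
  assumes "\<And>x. x \<in> tangent_hyperplanes \<Longrightarrow> eval_poly p x = 0"
  shows "eval_poly p 0 = 0"
proof -
  let ?x = "diag_array 0 1 1 0 0"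
  have "degenerate (scale_array s ?x)" for s
  proof -
    have "scale_array s ?x = diag_array 0 s s 0 0" by (rule array_ext3) simp_all
    then show ?thesis using degenerate_diag[of 0 s s 0 0] by simp
  qed
  moreover have "scale_array s ?x \<noteq> 0" if "s \<noteq> 0" for s
  proof
    assume "scale_array s ?x = 0"
    then have "scale_array s ?x $ 2 $ 2 $ 2 = 0" by simp
    then show False using that by simp
  qed
  ultimately have z: "eval_poly p (0 + scale_array s ?x) = 0" if "s \<notin> {0}" for s
    using that assms by (simp add: tangent_hyperplanes_iff)
  have "eval_poly p (0 + scale_array 0 ?x) = 0"
  proof (rule univariate_zero[OF polyfun_line[OF eval_poly_polyfun]])
    show "eval_poly p (0 + scale_array s ?x) = 0" if "s \<notin> {0}" for s
      using that by (rule z)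
  qed simp
  moreover have "0 + scale_array 0 ?x = 0" by (rule array_eqI) simp
  ultimately show ?thesis by simp
qed

theorem theorem3p1:
  fixes \<Delta> I6 I9 I12 :: array_poly
  assumes "is_hyperdeterminant \<Delta>"
    and "is_I6 I6" and "is_I9 I9" and "is_I12 I12"
  shows "\<exists>c. c \<noteq> 0 \<and>
    \<Delta> = const_poly c *
      (I6^3 * I9^2 - I6^2 * I12^2 + 36 * I6 * I9^2 * I12 + 108 * I9^4 - 32 * I12^3)"
proof -
  define D where
    "D = I6^3 * I9^2 - I6^2 * I12^2 + 36 * I6 * I9^2 * I12 + 108 * I9^4 - 32 * I12^3"
  have hom: "homogeneous_poly 6 I6" "homogeneous_poly 9 I9" "homogeneous_poly 12 I12"
    and inv: "invariant_poly I6" "invariant_poly I9" "invariant_poly I12"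
    using assms(2-4) by (simp_all add: is_I6_def is_I9_def is_I12_def)
  have hD: "homogeneous_poly 36 D"
  proof -
    have "homogeneous_poly (3 * 6 + 2 * 9) (I6^3 * I9^2)" "homogeneous_poly (2 * 6 + 2 * 12) (I6^2 * I12^2)"
      "homogeneous_poly (0 + 6 + 2 * 9 + 12) (36 * I6 * I9^2 * I12)"
      "homogeneous_poly (0 + 4 * 9) (108 * I9^4)" "homogeneous_poly (0 + 3 * 12) (32 * I12^3)"
      by (intro homogeneous_poly_mult homogeneous_poly_power homogeneous_poly_numeral hom)+
    then show ?thesis
      unfolding D_def by (intro homogeneous_poly_diff homogeneous_poly_add) simp_all
  qed
  interpret D: discriminant_like "eval_poly D"
  proof
    show "eval_poly D \<in> polyfuns entries" by (rule eval_poly_polyfun)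
    show "eval_poly D (scale_array t x) = t ^ 36 * eval_poly D x" for t x
      by (rule homogeneous_poly_scale[OF hD])
    show "eval_poly D (act A B C x) = eval_poly D x" if "det A = 1" "det B = 1" "det C = 1" for A B C x
      using inv that by (simp add: D_def invariant_poly_def SL3_def)
    fix a b c
    have v6: "eval_poly I6 (normal_array a b c) =
      a^6 + b^6 + c^6 - 10 * a^3 * b^3 - 10 * a^3 * c^3 - 10 * b^3 * c^3"
      using assms(2) unfolding is_I6_def by blast
    have v9: "eval_poly I9 (normal_array a b c) =
      - ((a - b) * (a - c) * (b - c) * (a^2 + a * b + b^2) * (a^2 + a * c + c^2) * (b^2 + b * c + c^2))"
      using assms(3) unfolding is_I9_def by blast
    have v12: "eval_poly I12 (normal_array a b c) =
      a^3 * b^9 + a^9 * b^3 + a^9 * c^3 + a^3 * c^9 + b^3 * c^9 + b^9 * c^3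
      - 4 * a^6 * b^6 - 4 * a^6 * c^6 - 4 * b^6 * c^6
      + 2 * a^3 * b^3 * c^6 + 2 * a^3 * b^6 * c^3 + 2 * a^6 * b^3 * c^3"
      using assms(4) unfolding is_I12_def by blast
    \<comment> \<open>The restrictions are symmetric functions of the cubes, the square of that of \<open>I9\<close> being
      the discriminant of a cubic. In elementary symmetric functions the identity becomes small.\<close>
    define X Y Z where "X = a^3" and "Y = b^3" and "Z = c^3"
    have pow: "a^6 = X^2" "b^6 = Y^2" "c^6 = Z^2" "a^9 = X^3" "b^9 = Y^3" "c^9 = Z^3"
      by (simp_all add: X_def Y_def Z_def flip: power_mult)
    have "(a - b) * (a^2 + a * b + b^2) = X - Y" "(a - c) * (a^2 + a * c + c^2) = X - Z"
      "(b - c) * (b^2 + b * c + c^2) = Y - Z"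
      by (simp_all add: X_def Y_def Z_def power2_eq_square power3_eq_cube algebra_simps)
    then have w9: "eval_poly I9 (normal_array a b c) = - ((X - Y) * (X - Z) * (Y - Z))"
    proof -
      assume e: "(a - b) * (a^2 + a * b + b^2) = X - Y" "(a - c) * (a^2 + a * c + c^2) = X - Z"
        "(b - c) * (b^2 + b * c + c^2) = Y - Z"
      have "(a - b) * (a - c) * (b - c) * (a^2 + a * b + b^2) * (a^2 + a * c + c^2) * (b^2 + b * c + c^2)
        = ((a - b) * (a^2 + a * b + b^2)) * ((a - c) * (a^2 + a * c + c^2)) * ((b - c) * (b^2 + b * c + c^2))"
        by (simp only: mult_ac)
      then show ?thesis unfolding v9 e by simp
    qed
    define e1 e2 e3 where "e1 = X + Y + Z" and "e2 = X * Y + X * Z + Y * Z" and "e3 = X * Y * Z"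
    have w6: "eval_poly I6 (normal_array a b c) = e1^2 - 12 * e2"
      unfolding v6 pow X_def[symmetric] Y_def[symmetric] Z_def[symmetric] e1_def e2_def by algebra
    have w12: "eval_poly I12 (normal_array a b c) = e1^2 * e2 - 6 * e2^2 + 9 * e1 * e3"
      unfolding v12 pow X_def[symmetric] Y_def[symmetric] Z_def[symmetric] e1_def e2_def e3_def by algebra
    have w9sq: "eval_poly I9 (normal_array a b c) ^ 2
        = e1^2 * e2^2 - 4 * e2^3 - 4 * e1^3 * e3 + 18 * e1 * e2 * e3 - 27 * e3^2"
      unfolding w9 e1_def e2_def e3_def by algebra
    have w9four: "eval_poly I9 (normal_array a b c) ^ 4 = (eval_poly I9 (normal_array a b c) ^ 2) ^ 2"
      by (simp flip: power_mult)
    have "eval_poly D (normal_array a b c) = - 4 * (e3 * (e1^3 - 27 * e3)^3)"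
      unfolding D_def eval_poly_diff eval_poly_add eval_poly_mult eval_poly_power eval_poly_numeral
        w9four w9sq w6 w12
      by algebra
    also have "\<dots> = - 4 * (\<Prod>l\<in>forms. form l a b c) ^ 3"
      unfolding prod_forms_value by (simp add: X_def Y_def Z_def e1_def e3_def power_mult_distrib)
    finally show "eval_poly D (normal_array a b c) = - 4 * (\<Prod>l\<in>forms. form l a b c) ^ 3" .
  qed
  have D0: "D \<noteq> 0" using D.F_normal_base by auto
  have "form_vanishing_on_dual 36 D"
    unfolding form_vanishing_on_dual_def vanishes_on_dual_iff[OF hD]
    using D0 hD D.F_degenerate by (simp add: tangent_hyperplanes_iff)
  moreover obtain d where d: "form_vanishing_on_dual d \<Delta>"
    "\<And>e p. form_vanishing_on_dual e p \<Longrightarrow> d \<le> e"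
    using assms(1) unfolding is_hyperdeterminant_def by blast
  ultimately have "d \<le> 36" by blast
  have \<Delta>: "\<Delta> \<noteq> 0" "homogeneous_poly d \<Delta>"
    "\<And>x. x \<in> tangent_hyperplanes \<Longrightarrow> eval_poly \<Delta> x = 0"
    using d(1) vanishes_on_dual_iff unfolding form_vanishing_on_dual_def by blast+
  interpret T: tangent_form "eval_poly D" "eval_poly \<Delta>"
  proof
    show "eval_poly \<Delta> \<in> polyfuns entries" by (rule eval_poly_polyfun)
    show "\<exists>P. degree P \<le> 36 \<and> (\<forall>s. eval_poly \<Delta> (x + scale_array s y) = poly P s)" for x y
      using homogeneous_poly_line[OF \<Delta>(2), of x y] \<open>d \<le> 36\<close> by (metis order.trans)
    show "eval_poly \<Delta> x = 0" if "degenerate x" for x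
      using \<Delta>(3) that vanishes_at_zero[of \<Delta>] by (cases "x = 0") (auto simp: tangent_hyperplanes_iff)
  qed
  have eq: "\<Delta> = const_poly (T.ratio gone) * D"
    by (rule eval_poly_inject) (simp add: T.tangent_form_proportional)
  then have "T.ratio gone \<noteq> 0" using \<Delta>(1) by (auto simp: const_poly_def)
  then show ?thesis using eq unfolding D_def by blast
qed

end
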